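(* Assume that $\nu$ satisfies the $(\alpha,1)$ Frostman condition and $$\alpha>-\frac{\kappa'(1)}{\log m}.$$ Then the mapping $I_\alpha\colon\mathfrak{W}\to L_1(\nu)$ is continuous.
   Context: Fix integers $m\ge 3$ and $\ell\ge 1$. Consider a probability space with an $m$-uniform filtration $\mathcal{F}=\{\mathcal{F}_n\}_{n\ge0}$: $\mathcal{F}_0$ is trivial, each $\mathcal{F}_n$ is a finite algebra with set of atoms $\mathcal{AF}_n$, and each atom in $\mathcal{F}_n$ is split into $m$ atoms of $\mathcal{F}_{n+1}$ (its children) of equal probability. The probability space is identified with the compact metric space $\mathbb{T}$ of infinite paths $\gamma=(\gamma(0)\supset\gamma(1)\supset\cdots)$, $\gamma(n)\in\mathcal{AF}_n$, in the tree of atoms, with $\mathrm{dist}(\gamma_1,\gamma_2)=m^{-d}$, $d=\max\{n : \gamma_1(j)=\gamma_2(j)\text{ for all }j<n\}$ for $\gamma_1\ne\gamma_2$; an atom $\omega\in\mathcal{AF}_n$ is identified with the cylinder $\{\gamma : \gamma(n)=\omega\}$, of probability $m^{-n}$, so $\mathcal{F}_n$-measurable functions are defined pointwise on $\mathbb{T}$. The norm $\|\cdot\|$ on $\mathbb{R}^\ell$ is Euclidean. Let $V=\{v\in\mathbb{R}^m : \sum_{j=1}^m v_j=0\}$. Elements of $V^\ell$ are identified with $m$-tuples $\{b_j\}_{j=1}^m$ of vectors $b_j\in\mathbb{R}^\ell$ with $\sum_j b_j=0$; for $v\in V$, $a\in\mathbb{R}^\ell$, $v\otimes a=\{v_j a\}_{j=1}^m$.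 For each $n$ and $\omega\in\mathcal{AF}_n$ fix a bijection $J_\omega$ from $\{1,\dots,m\}$ onto the set of children of $\omega$; for $b\in V^\ell$ let $J_\omega[b]$ be the function on $\omega$ equal to $b_j$ on the child $J_\omega(j)$. Let $W$ be a linear subspace of $V^\ell$. With $f_{n+1}=F_{n+1}-F_n$, let $\mathfrak{W}$ be the space of $\mathbb{R}^\ell$-valued martingales $F=\{F_n\}_{n\ge0}$ adapted to $\mathcal{F}$ with $\|F\|_{\mathfrak{W}}=\sup_n\mathbb{E}\|F_n\|<\infty$ and $f_{n+1}|_\omega\in J_\omega[W]$ for all $n\ge0$, $\omega\in\mathcal{AF}_n$. For $\alpha\in\mathbb{R}$, $I_\alpha[F]=\sum_{n\ge1}m^{-\alpha n}f_n$. Continuity of $I_\alpha\colon\mathfrak{W}\to L_1(\nu)$ means that this series converges in $L_1(\nu)$ for every $F\in\mathfrak{W}$ and $\|I_\alpha[F]\|_{L_1(\nu)}\le C\|F\|_{\mathfrak{W}}$ with $C$ independent of $F$. A finite non-negative Borel measure $\nu$ on $\mathbb{T}$ satisfies the $(\alpha,1)$ Frostman condition if there is a constant $C$ with $\nu(\omega)\le C m^{(\alpha-1)n}$ for all $n\ge0$ and all $\omega\in\mathcal{AF}_n$. For $v\in V$ and $\theta\in[0,\infty)$ put $\kappa_v(\theta)=\theta\log\big(\frac1m\sum_{j=1}^m|1+v_j|^{1/\theta}\big)$, with $\kappa_v(0)=\log\max_j|1+v_j|$, and $$\kappa(\theta)=\sup\{\kappa_v(\theta) : v\in V,\ \exists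 a\in\mathbb{R}^\ell\setminus\{0\}\text{ with } v\otimes a\in W,\text{ and } v_j\ge-1\ \forall j\}.$$ $\kappa'(1)$ is the (left) derivative of $\kappa$ at $1$; it equals $$\inf\Big\{-\frac1m\sum_{j=1}^m(1+v_j)\log(1+v_j) : v\in V,\ \exists a\in\mathbb{R}^\ell\setminus\{0\}\text{ with }v\otimes a\in W,\ v_j\ge-1\ \forall j\Big\}$$ (with $0\log0=0$). *)

theory Defs
  imports "HOL-Probability.Probability"
begin

section \<open>Uniform filtrations\<close>

definition atoms :: "'a set set \<Rightarrow> 'a set set" where
  "atoms A = {\<omega>\<in>A. \<omega> \<noteq> {} \<and> (\<forall>B\<in>A. B \<subseteq> \<omega> \<longrightarrow> B = {} \<or> B = \<omega>)}"

definition children :: "(nat \<Rightarrow> 'a set set) \<Rightarrow> nat \<Rightarrow> 'a set \<Rightarrow> 'a set set" where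
  "children \<F> n \<omega> = {\<omega>' \<in> atoms (\<F> (Suc n)). \<omega>' \<subseteq> \<omega>}"

definition uniform_filtration :: "nat \<Rightarrow> 'a measure \<Rightarrow> (nat \<Rightarrow> 'a set set) \<Rightarrow> bool" where
  "uniform_filtration m M \<F> \<longleftrightarrow>
     prob_space M \<and>
     \<F> 0 = {{}, space M} \<and>
     (\<forall>n. algebra (space M) (\<F> n) \<and> finite (\<F> n) \<and> \<F> n \<subseteq> sets M \<and> \<F> n \<subseteq> \<F> (Suc n)) \<and>
     (\<forall>n. \<forall>\<omega>\<in>atoms (\<F> n).
        card (children \<F> n \<omega>) = m \<and>
        (\<forall>\<omega>'\<in>children \<F> n \<omega>. \<forall>\<omega>''\<in>children \<F> n \<omega>. measure M \<omega>' = measure M \<omega>''))"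

text \<open>No level index is needed in the labelling of children: for \<open>m \<ge> 2\<close> an atom of
  \<open>\<F> n\<close> is an atom at no other level.\<close>

definition children_labelling ::
    "(nat \<Rightarrow> 'a set set) \<Rightarrow> ('a set \<Rightarrow> 'm::finite \<Rightarrow> 'a set) \<Rightarrow> bool" where
  "children_labelling \<F> J \<longleftrightarrow>
     (\<forall>n. \<forall>\<omega>\<in>atoms (\<F> n). bij_betw (J \<omega>) UNIV (children \<F> n \<omega>))"


section \<open>The space of infinite paths\<close>

definition paths :: "(nat \<Rightarrow> 'a set set) \<Rightarrow> (nat \<Rightarrow> 'a set) set" where
  "paths \<F> = {\<gamma>. \<forall>n. \<gamma> n \<in> atoms (\<F> n) \<and> \<gamma> (Suc n) \<in> children \<F> n (\<gamma> n)}"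

definition path_dist :: "nat \<Rightarrow> (nat \<Rightarrow> 'a set) \<Rightarrow> (nat \<Rightarrow> 'a set) \<Rightarrow> real" where
  "path_dist m \<gamma>\<^sub>1 \<gamma>\<^sub>2 =
     (if \<gamma>\<^sub>1 = \<gamma>\<^sub>2 then 0 else 1 / real m ^ Max {n. \<forall>j<n. \<gamma>\<^sub>1 j = \<gamma>\<^sub>2 j})"

lemma path_dist_le_iff:
  assumes m: "m \<ge> 2"
  shows "path_dist m \<gamma>\<^sub>1 \<gamma>\<^sub>2 \<le> 1 / real m ^ n \<longleftrightarrow> (\<forall>j<n. \<gamma>\<^sub>1 j = \<gamma>\<^sub>2 j)"
proof (cases "\<gamma>\<^sub>1 = \<gamma>\<^sub>2")
  case True
  then show ?thesis by (simp add: path_dist_def)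
next
  case False
  let ?S = "{n. \<forall>j<n. \<gamma>\<^sub>1 j = \<gamma>\<^sub>2 j}"
  obtain k where k: "\<gamma>\<^sub>1 k \<noteq> \<gamma>\<^sub>2 k" using False by blast
  have "?S \<subseteq> {..k}" using k by (auto simp: not_less[symmetric])
  then have fin: "finite ?S" by (rule finite_subset) simp
  have "0 \<in> ?S" by simp
  then have mem: "Max ?S \<in> ?S" using Max_in[OF fin] by blast
  have "n \<le> Max ?S \<longleftrightarrow> n \<in> ?S"
  proof
    assume "n \<le> Max ?S"
    then show "n \<in> ?S" using mem by auto
  next
    assume "n \<in> ?S"
    then show "n \<le> Max ?S" using Max_ge[OF fin] by blast
  qed
  moreover have "1 / real m ^ Max ?S \<le> 1 / real m ^ n \<longleftrightarrow> n \<le> Max ?S"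
    using m by (simp add: field_simps)
  ultimately show ?thesis using False by (simp add: path_dist_def)
qed

lemma Metric_space_path_dist:
  assumes m: "m \<ge> 2"
  shows "Metric_space S (path_dist m)"
proof
  fix x y z :: "nat \<Rightarrow> 'a set"
  show nonneg: "0 \<le> path_dist m x y" for x y :: "nat \<Rightarrow> 'a set"
    by (simp add: path_dist_def)
  show "path_dist m x y = path_dist m y x"
    by (simp add: path_dist_def eq_commute)
  show "path_dist m x y = 0 \<longleftrightarrow> x = y"
    using m by (simp add: path_dist_def)
  have val: "\<exists>n. path_dist m x y = 1 / real m ^ n" if "x \<noteq> y" for x y :: "nat \<Rightarrow> 'a set"
    using that by (auto simp: path_dist_def)
  have ultra: "path_dist m x z \<le> max (path_dist m x y) (path_dist m y z)"
  proof (cases "x = y \<or> y = z")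
    case True
    then show ?thesis by auto
  next
    case False
    then have "\<exists>n. max (path_dist m x y) (path_dist m y z) = 1 / real m ^ n"
      using val[of x y] val[of y z] by (auto simp: max_def)
    then obtain n where n: "max (path_dist m x y) (path_dist m y z) = 1 / real m ^ n" ..
    then have "path_dist m x y \<le> 1 / real m ^ n" "path_dist m y z \<le> 1 / real m ^ n"
      by linarith+
    then show ?thesis
      using path_dist_le_iff[OF m] n by metis
  qed
  then show "path_dist m x z \<le> path_dist m x y + path_dist m y z"
    using nonneg[of x y] nonneg[of y z] by linarith
qed

definition finite_borel_measure_on_paths ::
    "nat \<Rightarrow> (nat \<Rightarrow> 'a set set) \<Rightarrow> (nat \<Rightarrow> 'a set) measure \<Rightarrow> bool" where
  "finite_borel_measure_on_paths m \<F> \<nu> \<longleftrightarrow>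
     finite_measure \<nu> \<and>
     space \<nu> = paths \<F> \<and>
     sets \<nu> = sigma_sets (paths \<F>)
       {U. openin (Metric_space.mtopology (paths \<F>) (path_dist m)) U}"

definition cylinder :: "(nat \<Rightarrow> 'a set set) \<Rightarrow> nat \<Rightarrow> 'a set \<Rightarrow> (nat \<Rightarrow> 'a set) set" where
  "cylinder \<F> n \<omega> = {\<gamma> \<in> paths \<F>. \<gamma> n = \<omega>}"

definition frostman ::
    "nat \<Rightarrow> (nat \<Rightarrow> 'a set set) \<Rightarrow> real \<Rightarrow> (nat \<Rightarrow> 'a set) measure \<Rightarrow> bool" where
  "frostman m \<F> \<alpha> \<nu> \<longleftrightarrow>
     (\<exists>C. \<forall>n. \<forall>\<omega>\<in>atoms (\<F> n).
        measure \<nu> (cylinder \<F> n \<omega>) \<le> C * real m powr ((\<alpha> - 1) * real n))"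

text \<open>An \<open>\<F> n\<close>-measurable function is constant on the atoms of \<open>\<F> n\<close>, so the choice of
  the point in the atom \<open>\<gamma> n\<close> is immaterial.\<close>

definition on_paths :: "nat \<Rightarrow> ('a \<Rightarrow> 'b) \<Rightarrow> (nat \<Rightarrow> 'a set) \<Rightarrow> 'b" where
  "on_paths n g \<gamma> = g (SOME x. x \<in> \<gamma> n)"


section \<open>Martingales with prescribed differences\<close>

definition V :: "(real ^ 'm) set" where
  "V = {v. (\<Sum>j\<in>UNIV. v $ j) = 0}"

definition V_pow :: "((real ^ 'l) ^ 'm) set" where
  "V_pow = {b. (\<Sum>j\<in>UNIV. b $ j) = 0}"

definition tensor :: "real ^ 'm \<Rightarrow> real ^ 'l \<Rightarrow> (real ^ 'l) ^ 'm" (infixl \<open>\<otimes>\<^sub>v\<close> 70) where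
  "v \<otimes>\<^sub>v a = (\<chi> j. v $ j *\<^sub>R a)"

definition martingale ::
    "'a measure \<Rightarrow> (nat \<Rightarrow> 'a set set) \<Rightarrow> (nat \<Rightarrow> 'a \<Rightarrow> real ^ 'l) \<Rightarrow> bool" where
  "martingale M \<F> F \<longleftrightarrow>
     (\<forall>n. F n \<in> borel_measurable (sigma (space M) (\<F> n)) \<and> integrable M (F n)) \<and>
     (\<forall>n. \<forall>A\<in>\<F> n. (LINT x:A|M. F (Suc n) x) = (LINT x:A|M. F n x))"

definition martingale_diff :: "(nat \<Rightarrow> 'a \<Rightarrow> real ^ 'l) \<Rightarrow> nat \<Rightarrow> 'a \<Rightarrow> real ^ 'l" where
  "martingale_diff F n x = F n x - F (n - 1) x"

text \<open>The condition that the difference \<open>f (Suc n)\<close>, restricted to an atom \<open>\<omega>\<close> of \<open>\<F> n\<close>,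
  equals \<open>J\<^sub>\<omega>[b]\<close> for some \<open>b \<in> W\<close> is spelled out on the children \<open>J \<omega> j\<close> of \<open>\<omega>\<close>.\<close>

definition \<WW> ::
    "'a measure \<Rightarrow> (nat \<Rightarrow> 'a set set) \<Rightarrow> ('a set \<Rightarrow> 'm::finite \<Rightarrow> 'a set) \<Rightarrow>
     ((real ^ 'l) ^ 'm) set \<Rightarrow> (nat \<Rightarrow> 'a \<Rightarrow> real ^ 'l) set" where
  "\<WW> M \<F> J W =
     {F. martingale M \<F> F \<and>
         bdd_above (range (\<lambda>n. LINT x|M. norm (F n x))) \<and>
         (\<forall>n. \<forall>\<omega>\<in>atoms (\<F> n).
            \<exists>b\<in>W. \<forall>j. \<forall>x\<in>J \<omega> j. martingale_diff F (Suc n) x = b $ j)}"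

definition norm_\<WW> :: "'a measure \<Rightarrow> (nat \<Rightarrow> 'a \<Rightarrow> real ^ 'l) \<Rightarrow> real" where
  "norm_\<WW> M F = (SUP n. LINT x|M. norm (F n x))"


section \<open>The Riesz potential\<close>

definition riesz_partial_sum ::
    "nat \<Rightarrow> real \<Rightarrow> (nat \<Rightarrow> 'a \<Rightarrow> real ^ 'l) \<Rightarrow> nat \<Rightarrow> (nat \<Rightarrow> 'a set) \<Rightarrow> real ^ 'l" where
  "riesz_partial_sum m \<alpha> F N \<gamma> =
     (\<Sum>n=1..N. (real m powr (- \<alpha> * real n)) *\<^sub>R on_paths n (martingale_diff F n) \<gamma>)"

definition L1_converges ::
    "'b measure \<Rightarrow> (nat \<Rightarrow> 'b \<Rightarrow> real ^ 'l) \<Rightarrow> ('b \<Rightarrow> real ^ 'l) \<Rightarrow> bool" where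
  "L1_converges \<nu> S G \<longleftrightarrow>
     (\<forall>N. integrable \<nu> (S N)) \<and> integrable \<nu> G \<and>
     (\<lambda>N. LINT \<gamma>|\<nu>. norm (S N \<gamma> - G \<gamma>)) \<longlonglongrightarrow> 0"

definition riesz_continuous ::
    "nat \<Rightarrow> real \<Rightarrow> 'a measure \<Rightarrow> (nat \<Rightarrow> 'a \<Rightarrow> real ^ 'l) set \<Rightarrow>
     (nat \<Rightarrow> 'a set) measure \<Rightarrow> bool" where
  "riesz_continuous m \<alpha> M X \<nu> \<longleftrightarrow>
     (\<exists>C. \<forall>F\<in>X. \<exists>G. L1_converges \<nu> (riesz_partial_sum m \<alpha> F) G \<and>
                    (LINT \<gamma>|\<nu>. norm (G \<gamma>)) \<le> C * norm_\<WW> M F)"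


section \<open>The function \<open>\<kappa>\<close>\<close>

definition kappa_v :: "real ^ 'm \<Rightarrow> real \<Rightarrow> real" where
  "kappa_v v \<theta> =
     (if \<theta> = 0 then ln (Max (range (\<lambda>j. \<bar>1 + v $ j\<bar>)))
      else \<theta> * ln ((1 / real CARD('m)) * (\<Sum>j\<in>UNIV. \<bar>1 + v $ j\<bar> powr (1 / \<theta>))))"

definition kappa_dom :: "((real ^ 'l) ^ 'm) set \<Rightarrow> (real ^ 'm) set" where
  "kappa_dom W = {v \<in> V. (\<exists>a. a \<noteq> 0 \<and> v \<otimes>\<^sub>v a \<in> W) \<and> (\<forall>j. v $ j \<ge> -1)}"

text \<open>For \<open>0 \<in> W\<close> the supremum is over a nonempty set that is bounded above: \<open>0 \<in> kappa_dom W\<close>,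
  and \<open>0 \<le> 1 + v $ j \<le> m\<close> on \<open>kappa_dom W\<close>.\<close>

definition kappa :: "((real ^ 'l) ^ 'm) set \<Rightarrow> real \<Rightarrow> real" where
  "kappa W \<theta> = (SUP v\<in>kappa_dom W. kappa_v v \<theta>)"

text \<open>The left derivative at \<open>1\<close> exists, as \<open>kappa W\<close> is a finite-valued pointwise supremum of the convex functions
  \<open>\<theta> \<mapsto> log \<parallel>1 + v\<parallel>\<close> (norm in \<open>L\<close> with exponent \<open>1 / \<theta>\<close>), hence convex on \<open>[0, \<infinity>)\<close>.\<close>

definition kappa_left_deriv_1 :: "((real ^ 'l) ^ 'm) set \<Rightarrow> real" where
  "kappa_left_deriv_1 W = (THE D. (kappa W has_real_derivative D) (at_left 1))"

end

theory Submission
  imports Defs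
begin

text \<open>
Write \<open>m\<close> for the number of children and \<open>F\<^sub>n(\<omega>)\<close> for the value of \<open>F\<^sub>n\<close> on an atom \<open>\<omega>\<close> of level
\<open>n\<close>, and let \<open>K\<^sub>n = C m\<^bsup>(\<alpha>-1)n\<^esup>\<close> be the Frostman bound for \<open>\<nu>(\<omega>)\<close>. The crude estimate of the \<open>n\<close>-th
term of the potential, \<open>\<nu>(\<omega>) \<le> K\<^sub>n\<close>, gives a multiple of the expectation of \<open>\<parallel>f\<^sub>n\<parallel>\<close>, and these
need not be summable. The gain comes from a dichotomy for the splittings of atoms.

A splitting of \<open>x = F\<^sub>n(\<omega>)\<close> into \<open>x + b\<^sub>1, ..., x + b\<^sub>m\<close> with \<open>b \<in> W\<close> is flat if the mean of
\<open>\<parallel>x + b\<^sub>j\<parallel>\<close> is at most \<open>(1 + \<epsilon>) \<parallel>x\<parallel>\<close>. At a splitting that is not flat, the mean norm is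
controlled by its own increase, and all the increases together telescope to at most the norm of \<open>F\<close>. A
flat splitting is close to equality in the triangle inequality, that is, to \<open>b = v \<otimes> x\<close> with
\<open>v\<^sub>j \<ge> -1\<close>; by compactness its growth in the norm of exponent \<open>1 / t\<close> is hardly larger than
\<open>exp (\<kappa>(t))\<close> (lemma \<open>flat_growth\<close>).

Both cases are captured by the energy
\<open>U\<^sub>n = \<Sum>\<^sub>\<omega> m\<^bsup>-\<alpha>n\<^esup> \<parallel>F\<^sub>n(\<omega>)\<parallel> \<nu>(\<omega>)\<^bsup>1-t\<^esup> K\<^sub>n\<^bsup>t\<^esup>\<close> with a fixed \<open>t < 1\<close>. It dominates the integral of
\<open>m\<^bsup>-\<alpha>n\<^esup> \<parallel>F\<^sub>n\<parallel>\<close> over \<open>\<nu>\<close>. By Hoelder's inequality a flat splitting multiplies it by at most a number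
close to \<open>\<rho> = exp (\<kappa>(t) - \<alpha> (1 - t) log m)\<close>. As \<open>\<kappa>(1) = 0\<close>, the hypothesis
\<open>\<alpha> log m > - \<kappa>'(1)\<close> gives \<open>\<rho> < 1\<close> for \<open>t\<close> close to \<open>1\<close> (lemma \<open>exists_exponent_below_alpha\<close>).
Together, for some \<open>\<rho> < 1\<close> and some \<open>D\<close>, the energy satisfies
\<open>U\<^sub>n\<^sub>+\<^sub>1 \<le> \<rho> U\<^sub>n + D (\<parallel>F\<^sub>n\<^sub>+\<^sub>1\<parallel>\<^sub>1 - \<parallel>F\<^sub>n\<parallel>\<^sub>1)\<close> (lemma \<open>energy_step\<close>), where \<open>\<parallel>\<cdot>\<parallel>\<^sub>1\<close> is the norm in the
mean. Summation bounds \<open>\<Sum>\<^sub>n U\<^sub>n\<close> by a multiple of the norm of \<open>F\<close>, and with it the sum of the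
\<open>L\<^sub>1(\<nu>)\<close> norms of all terms of the potential.\<close>

section \<open>Two power inequalities\<close>

text \<open>Jensen's inequality for the power function. The points of weight zero are discarded first, since
they may lie outside \<open>{0<..}\<close>, where the library knows the power function to be convex.\<close>

lemma power_mean_weighted:
  fixes w y :: "'i \<Rightarrow> real"
  assumes fin: "finite I" and w0: "\<And>i. i \<in> I \<Longrightarrow> 0 \<le> w i" and w1: "(\<Sum>i\<in>I. w i) = 1"
    and y: "\<And>i. i \<in> I \<Longrightarrow> 0 < w i \<Longrightarrow> 0 < y i" and q: "q \<ge> 1"
  shows "(\<Sum>i\<in>I. w i * y i) powr q \<le> (\<Sum>i\<in>I. w i * y i powr q)"
proof -
  let ?K = "{i\<in>I. 0 < w i}"
  have restr: "(\<Sum>i\<in>?K. w i * h i) = (\<Sum>i\<in>I. w i * h i)" for h :: "'i \<Rightarrow> real"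
    using fin w0 by (intro sum.mono_neutral_left) (auto simp: order.order_iff_strict)
  have sum1: "(\<Sum>i\<in>?K. w i) = 1"
    using restr[of "\<lambda>_. 1"] w1 by simp
  then have "?K \<noteq> {}" by (metis (no_types, lifting) sum.empty zero_neq_one)
  with fin sum1 y q
  have "(\<Sum>i\<in>?K. w i *\<^sub>R y i) powr q \<le> (\<Sum>i\<in>?K. w i * y i powr q)"
    by (intro convex_on_sum[OF _ _ powr_convex[OF q]]) auto
  then show ?thesis by (simp add: restr)
qed

text \<open>Hoelder's inequality with exponents \<open>1 / t\<close> and \<open>1 / (1 - t)\<close>: normalise both sums to \<open>1\<close>
and add up Young's inequality.\<close>

lemma Holder_sum_powr:
  fixes a c :: "'i \<Rightarrow> real"
  assumes fin: "finite I" and a: "\<And>i. i \<in> I \<Longrightarrow> 0 \<le> a i" and c: "\<And>i. i \<in> I \<Longrightarrow> 0 \<le> c i"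
    and t: "0 < t" "t < 1"
  shows "(\<Sum>i\<in>I. a i * c i powr (1 - t))
           \<le> (\<Sum>i\<in>I. a i powr (1 / t)) powr t * (\<Sum>i\<in>I. c i) powr (1 - t)"
proof -
  let ?A = "\<Sum>i\<in>I. a i powr (1 / t)" and ?C = "\<Sum>i\<in>I. c i"
  have A0: "0 \<le> ?A" and C0: "0 \<le> ?C" using c by (auto intro: sum_nonneg)
  show ?thesis
  proof (cases "?A = 0 \<or> ?C = 0")
    case True
    have "a i * c i powr (1 - t) = 0" if i: "i \<in> I" for i
    proof (cases "?A = 0")
      case True
      then have "a i powr (1 / t) = 0"
        using fin i by (simp add: sum_nonneg_eq_0_iff)
      then show ?thesis by simp
    next
      case False
      then have "?C = 0" using True by blast
      then have "c i = 0"
        using fin i c by (subst (asm) sum_nonneg_eq_0_iff) auto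
      then show ?thesis by simp
    qed
    then have "(\<Sum>i\<in>I. a i * c i powr (1 - t)) = 0" by (rule sum.neutral[OF ballI])
    then show ?thesis by simp
  next
    case False
    then have A: "0 < ?A" and C: "0 < ?C" using A0 C0 by auto
    let ?P = "?A powr t * ?C powr (1 - t)"
    have P: "0 < ?P" using A C by simp
    have "a i * c i powr (1 - t) \<le> ?P * (t * (a i powr (1 / t) / ?A) + (1 - t) * (c i / ?C))"
      if i: "i \<in> I" for i
    proof -
      have "a i * c i powr (1 - t) = ?P * ((a i powr (1 / t) / ?A) powr t * (c i / ?C) powr (1 - t))"
        using A C a[OF i] c[OF i] t by (simp add: powr_divide powr_powr)
      also have "\<dots> \<le> ?P * (t * (a i powr (1 / t) / ?A) + (1 - t) * (c i / ?C))"
      proof (cases "a i = 0 \<or> c i = 0")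
        case True
        then show ?thesis
          using A C a[OF i] c[OF i] t by (intro mult_left_mono) auto
      next
        case False
        then show ?thesis
          using A C a[OF i] c[OF i] t by (intro mult_left_mono Youngs_inequality_0) auto
      qed
      finally show ?thesis .
    qed
    then have "(\<Sum>i\<in>I. a i * c i powr (1 - t))
        \<le> (\<Sum>i\<in>I. ?P * (t * (a i powr (1 / t) / ?A) + (1 - t) * (c i / ?C)))"
      by (rule sum_mono)
    also have "\<dots> = ?P * ((\<Sum>i\<in>I. t * (a i powr (1 / t) / ?A)) + (\<Sum>i\<in>I. (1 - t) * (c i / ?C)))"
      by (simp only: sum_distrib_left[symmetric] sum.distrib)
    also have "(\<Sum>i\<in>I. t * (a i powr (1 / t) / ?A)) = t * (?A / ?A)"
      by (simp only: sum_distrib_left sum_divide_distrib)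
    also have "(\<Sum>i\<in>I. (1 - t) * (c i / ?C)) = (1 - t) * (?C / ?C)"
      by (simp only: sum_distrib_left sum_divide_distrib)
    also have "?P * (t * (?A / ?A) + (1 - t) * (?C / ?C)) = ?P" using A C by simp
    finally show ?thesis .
  qed
qed

section \<open>The function kappa near 1\<close>

lemma kappa_dom_bounds:
  fixes v :: "real ^ 'm"
  assumes "v \<in> kappa_dom W"
  shows "(\<Sum>j\<in>UNIV. (1 + v $ j)) = real CARD('m)" and "0 \<le> 1 + v $ j"
    and "1 + v $ j \<le> real CARD('m)"
proof -
  show S: "(\<Sum>j\<in>UNIV. (1 + v $ j)) = real CARD('m)"
    using assms by (simp add: kappa_dom_def V_def sum.distrib)
  show nn: "0 \<le> 1 + v $ j" for j
  proof -
    have "-1 \<le> v $ j" using assms by (auto simp: kappa_dom_def)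
    then show ?thesis by linarith
  qed
  have "1 + v $ j \<le> (\<Sum>j\<in>UNIV. (1 + v $ j))"
    by (rule member_le_sum) (auto simp: nn)
  then show "1 + v $ j \<le> real CARD('m)" by (simp only: S)
qed

lemma mean_powr_pos:
  fixes v :: "real ^ 'm"
  assumes "v \<in> kappa_dom W"
  shows "0 < (1 / real CARD('m)) * (\<Sum>j\<in>UNIV. \<bar>1 + v $ j\<bar> powr p)"
proof -
  have "\<exists>j. 1 + v $ j \<noteq> 0"
  proof (rule ccontr)
    assume "\<not> ?thesis"
    then have "(\<Sum>j\<in>UNIV. (1 + v $ j)) = 0" by (intro sum.neutral) auto
    then show False by (simp only: kappa_dom_bounds(1)[OF assms]) simp
  qed
  then obtain j where "1 + v $ j \<noteq> 0" ..
  then have "0 < \<bar>1 + v $ j\<bar> powr p" by simp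
  also have "\<dots> \<le> (\<Sum>j\<in>UNIV. \<bar>1 + v $ j\<bar> powr p)"
    by (rule member_le_sum) auto
  finally show ?thesis by simp
qed

lemma bdd_above_kappa_v:
  fixes W :: "((real ^ 'l) ^ 'm) set"
  assumes "0 < t"
  shows "bdd_above ((\<lambda>v. kappa_v v t) ` kappa_dom W)"
proof (rule bdd_aboveI2)
  fix v assume v: "v \<in> kappa_dom W"
  let ?m = "real CARD('m)"
  let ?A = "(1 / ?m) * (\<Sum>j\<in>UNIV. \<bar>1 + v $ j\<bar> powr (1 / t))"
  have "(\<Sum>j\<in>UNIV. \<bar>1 + v $ j\<bar> powr (1 / t)) \<le> (\<Sum>j\<in>(UNIV :: 'm set). ?m powr (1 / t))"
    using kappa_dom_bounds[OF v] assms by (intro sum_mono powr_mono2) auto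
  then have "?A \<le> ?m powr (1 / t)"
    by (simp add: field_simps)
  then have "ln ?A \<le> (1 / t) * ln ?m"
    using mean_powr_pos[OF v, of "1/t"] by (subst ln_powr[symmetric]) (simp_all only: ln_mono)
  then show "kappa_v v t \<le> ln ?m"
    using assms by (simp add: kappa_v_def field_simps)
qed

lemma kappa_v_le_kappa:
  assumes "0 < t" "v \<in> kappa_dom W"
  shows "kappa_v v t \<le> kappa W t"
  unfolding kappa_def by (rule cSUP_upper[OF assms(2) bdd_above_kappa_v[OF assms(1)]])

lemma zero_in_kappa_dom:
  assumes "subspace (W :: ((real ^ 'l) ^ 'm) set)"
  shows "0 \<in> kappa_dom W"
proof -
  have "(0 :: real ^ 'm) \<otimes>\<^sub>v (1 :: real ^ 'l) = 0"
    by (simp add: tensor_def vec_eq_iff)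
  moreover have "(1 :: real ^ 'l) \<noteq> 0"
    by (simp add: vec_eq_iff)
  ultimately show ?thesis
    using subspace_0[OF assms] unfolding kappa_dom_def V_def by (auto intro!: exI[of _ 1])
qed

lemma kappa_1: "subspace W \<Longrightarrow> kappa W 1 = 0"
proof -
  assume "subspace W"
  then have ne: "kappa_dom W \<noteq> {}" using zero_in_kappa_dom by blast
  have "kappa_v v 1 = 0" if "v \<in> kappa_dom W" for v
    using kappa_dom_bounds[OF that] by (simp add: kappa_v_def)
  then show ?thesis using ne by (simp add: kappa_def)
qed

lemma kappa_nonneg:
  fixes W :: "((real ^ 'l) ^ 'm) set"
  assumes "subspace W" "0 < t"
  shows "0 \<le> kappa W t"
proof -
  have "0 = kappa_v (0 :: real ^ 'm) t" using assms by (simp add: kappa_v_def)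
  also have "\<dots> \<le> kappa W t" by (rule kappa_v_le_kappa[OF assms(2) zero_in_kappa_dom[OF assms(1)]])
  finally show ?thesis .
qed

text \<open>The numbers \<open>w j = (1 + v $ j) / m\<close> are the weights of a probability distribution, and with
\<open>p = 1 / t\<close> the quantity \<open>kappa_v v t / (1 - t)\<close> is the logarithm of the power mean of order
\<open>p - 1\<close> of the numbers \<open>1 + v $ j\<close> under \<open>w\<close>. Power means increase with their order, so the
quotient decreases in \<open>t\<close>. This monotonicity yields the one-sided derivative of \<open>kappa\<close> at \<open>1\<close>.\<close>

lemma kappa_v_slope_antimono:
  fixes v :: "real ^ 'm"
  assumes v: "v \<in> kappa_dom W" and st: "0 < s" "s \<le> t" "t < 1"
  shows "kappa_v v t / (1 - t) \<le> kappa_v v s / (1 - s)"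
proof -
  let ?m = "real CARD('m)" and ?g = "\<lambda>j. 1 + v $ j"
  \<comment> \<open>The ratio of the orders \<open>1 / s - 1\<close> and \<open>1 / t - 1\<close> of the two power means.\<close>
  define q where "q = (1 / s - 1) / (1 / t - 1)"
  have pt: "0 < 1 / t - 1" and ps: "0 < 1 / s - 1" and q: "1 \<le> q"
    using st by (auto simp: q_def field_simps)
  have pq: "(1 / t - 1) * q = 1 / s - 1" unfolding q_def using pt by (simp only: nonzero_mult_div_cancel_left times_divide_eq_right)
  have A: "(1 / ?m) * (\<Sum>j\<in>UNIV. \<bar>?g j\<bar> powr p) = (\<Sum>j\<in>UNIV. ?g j / ?m * ?g j powr (p - 1))"
    for p
    unfolding sum_distrib_left
  proof (rule sum.cong)
    fix j :: 'm
    show "1 / ?m * \<bar>?g j\<bar> powr p = ?g j / ?m * ?g j powr (p - 1)"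
      using kappa_dom_bounds(2)[OF v, of j] by (cases "?g j = 0") (auto simp: powr_diff)
  qed simp
  have "(\<Sum>j\<in>UNIV. ?g j / ?m * ?g j powr (1 / t - 1)) powr q
      \<le> (\<Sum>j\<in>UNIV. ?g j / ?m * (?g j powr (1 / t - 1)) powr q)"
    using kappa_dom_bounds[OF v] q
    by (intro power_mean_weighted) (auto simp flip: sum_divide_distrib simp: zero_less_divide_iff)
  also have "\<dots> = (\<Sum>j\<in>UNIV. ?g j / ?m * ?g j powr (1 / s - 1))"
    by (simp only: powr_powr pq)
  finally have "((1 / ?m) * (\<Sum>j\<in>UNIV. \<bar>?g j\<bar> powr (1 / t))) powr q
      \<le> (1 / ?m) * (\<Sum>j\<in>UNIV. \<bar>?g j\<bar> powr (1 / s))"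
    unfolding A .
  then have "q * ln ((1 / ?m) * (\<Sum>j\<in>UNIV. \<bar>?g j\<bar> powr (1 / t)))
      \<le> ln ((1 / ?m) * (\<Sum>j\<in>UNIV. \<bar>?g j\<bar> powr (1 / s)))" (is "q * ?X \<le> ?Y")
    using mean_powr_pos[OF v, of "1 / t"]
    by (subst ln_powr[symmetric]) (auto intro!: ln_mono simp only: powr_gt_zero)
  then have "?X / (1 / t - 1) \<le> ?Y / (1 / s - 1)"
    using pt ps by (simp add: q_def field_simps)
  moreover have "t / (1 - t) = 1 / (1 / t - 1)" "s / (1 - s) = 1 / (1 / s - 1)"
    using st by (auto simp: field_simps)
  ultimately show ?thesis
    using st unfolding kappa_v_def by (simp add: field_simps)
qed

lemma kappa_slope_antimono:
  assumes W: "subspace W" and st: "0 < s" "s \<le> t" "t < 1"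
  shows "kappa W t / (1 - t) \<le> kappa W s / (1 - s)"
proof -
  have "kappa W t \<le> (1 - t) * (kappa W s / (1 - s))"
    unfolding kappa_def[of W t]
  proof (rule cSUP_least)
    show "kappa_dom W \<noteq> {}" using zero_in_kappa_dom[OF W] by blast
    fix v assume v: "v \<in> kappa_dom W"
    have "kappa_v v t / (1 - t) \<le> kappa_v v s / (1 - s)"
      by (rule kappa_v_slope_antimono[OF v st])
    also have "\<dots> \<le> kappa W s / (1 - s)"
      using kappa_v_le_kappa[OF st(1) v] st by (intro divide_right_mono) auto
    finally show "kappa_v v t \<le> (1 - t) * (kappa W s / (1 - s))"
      using st by (simp add: pos_divide_le_eq mult.commute)
  qed
  then show ?thesis using st by (simp add: pos_divide_le_eq mult.commute)
qed

text \<open>The difference quotients from the left at \<open>1\<close> are monotone and bounded by \<open>0\<close>, so they converge;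
this identifies the description in \<open>kappa_left_deriv_1\<close> with an actual limit.\<close>

lemma kappa_left_deriv_1_tendsto:
  assumes W: "subspace W"
  shows "((\<lambda>t. kappa W t / (t - 1)) \<longlongrightarrow> kappa_left_deriv_1 W) (at_left 1)"
proof -
  let ?f = "\<lambda>t. kappa W t / (t - 1)"
  let ?L = "SUP t\<in>{0<..<1}. ?f t"
  have neg: "?f t = - (kappa W t / (1 - t))" for t
    using minus_diff_eq[of 1 t] by (metis divide_minus_right)
  have mono: "?f s \<le> ?f t" if "0 < s" "s \<le> t" "t < 1" for s t
    using kappa_slope_antimono[OF W that] by (simp only: neg)
  have bdd: "bdd_above (?f ` {0<..<1})"
    by (rule bdd_aboveI2[of _ _ 0]) (use kappa_nonneg[OF W] in \<open>auto simp: neg\<close>)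
  have near1: "\<forall>\<^sub>F t in at_left 1. r < t \<and> t < 1" if "r < 1" for r :: real
    using that by (simp add: eventually_at_left_field) blast
  have lim: "(?f \<longlongrightarrow> ?L) (at_left 1)"
  proof (rule increasing_tendsto)
    show "\<forall>\<^sub>F t in at_left 1. ?f t \<le> ?L"
      by (rule eventually_mono[OF near1[of 0]]) (auto intro!: cSUP_upper[OF _ bdd])
    fix x assume "x < ?L"
    then obtain s where s: "0 < s" "s < 1" "x < ?f s"
      using less_cSUP_iff[OF _ bdd] by auto
    show "\<forall>\<^sub>F t in at_left 1. x < ?f t"
      using near1[OF s(2)] by eventually_elim (use mono[OF s(1)] s in \<open>force intro: less_le_trans\<close>)
  qed
  have iff: "(kappa W has_real_derivative D) (at_left 1) \<longleftrightarrow> (?f \<longlongrightarrow> D) (at_left 1)" for D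
    by (simp add: has_field_derivative_iff kappa_1[OF W])
  have "kappa_left_deriv_1 W = ?L"
    unfolding kappa_left_deriv_1_def iff
  proof (rule the_equality)
    show "D = ?L" if "(?f \<longlongrightarrow> D) (at_left 1)" for D
      by (rule tendsto_unique[OF _ that lim]) simp
  qed (rule lim)
  then show ?thesis using lim by simp
qed

text \<open>The hypothesis on \<open>\<alpha>\<close> enters the proof only in this form. The exponent \<open>t\<close> stays fixed from
here on; the strict inequality is what makes the energy contract on flat splittings.\<close>

lemma exists_exponent_below_alpha:
  assumes W: "subspace W" and m: "1 < m" and \<alpha>: "\<alpha> > - kappa_left_deriv_1 W / ln m"
  obtains t where "0 < t" "t < 1" "kappa W t < \<alpha> * (1 - t) * ln m"
proof -
  have "- \<alpha> * ln m < kappa_left_deriv_1 W"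
    using \<alpha> m by (simp add: field_simps)
  then have "\<forall>\<^sub>F t in at_left 1. - \<alpha> * ln m < kappa W t / (t - 1)"
    by (rule order_tendstoD(1)[OF kappa_left_deriv_1_tendsto[OF W]])
  then obtain b where b: "b < 1" "\<And>t. b < t \<Longrightarrow> t < 1 \<Longrightarrow> - \<alpha> * ln m < kappa W t / (t - 1)"
    by (auto simp: eventually_at_left_field)
  define t where "t = (max b 0 + 1) / 2"
  have t: "0 < t" "t < 1" "b < t" using b by (auto simp: t_def)
  have "kappa W t < \<alpha> * (1 - t) * ln m"
    using b(2)[OF t(3,2)] t by (simp add: field_simps)
  then show ?thesis using that t by blast
qed

section \<open>Flat splittings of a vector\<close>

definition avg :: "('m::finite \<Rightarrow> real) \<Rightarrow> real" where
  "avg h = (\<Sum>j\<in>UNIV. h j) / real CARD('m)"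

lemma avg_mult_right: "avg (\<lambda>j. h j * c) = avg h * c"
  by (simp add: avg_def sum_distrib_right)

lemma avg_norm_ge:
  fixes b :: "(real ^ 'l) ^ 'm" and x :: "real ^ 'l"
  assumes "b \<in> V_pow"
  shows "norm x \<le> avg (\<lambda>j. norm (x + b $ j))"
proof -
  have "real CARD('m) * norm x = norm (\<Sum>j\<in>UNIV. x + b $ j)"
  proof -
    have "(\<Sum>j\<in>UNIV. x + b $ j) = real CARD('m) *\<^sub>R x"
      unfolding sum.distrib sum_constant_scaleR using assms by (simp add: V_pow_def)
    then show ?thesis by (simp only: norm_scaleR abs_of_nat)
  qed
  also have "\<dots> \<le> (\<Sum>j\<in>UNIV. norm (x + b $ j))"
    by (rule norm_sum)
  finally show ?thesis
    by (simp add: avg_def field_simps)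
qed

text \<open>Equality in the triangle inequality forces all vectors \<open>x + b $ j\<close> to be nonnegative multiples of
\<open>x\<close>. Hence \<open>b = v \<otimes>\<^sub>v x\<close> with \<open>v $ j \<ge> -1\<close>: this is how \<open>kappa_dom W\<close> arises.\<close>

lemma avg_norm_eq_imp_rank_one:
  fixes b :: "(real ^ 'l) ^ 'm" and x :: "real ^ 'l"
  assumes b: "b \<in> W" "W \<subseteq> V_pow" and x: "norm x = 1"
    and eq: "avg (\<lambda>j. norm (x + b $ j)) = 1"
  obtains v where "v \<in> kappa_dom W" "\<And>j. norm (x + b $ j) = 1 + v $ j"
proof -
  have bs: "(\<Sum>j\<in>UNIV. b $ j) = 0" using b by (auto simp: V_pow_def)
  have xx: "x \<bullet> x = 1" using x by (simp add: dot_square_norm)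
  define h where "h j = norm (x + b $ j)" for j
  have hs: "(\<Sum>j\<in>UNIV. h j) = real CARD('m)"
    using eq by (simp add: avg_def h_def field_simps)
  have "(\<Sum>j\<in>UNIV. (x + b $ j) \<bullet> x) = real CARD('m)"
  proof -
    have "(\<Sum>j\<in>UNIV. b $ j \<bullet> x) = 0"
      by (simp only: inner_sum_left[symmetric] bs inner_zero_left)
    then show ?thesis by (simp only: inner_add_left sum.distrib xx sum_constant)
  qed
  then have "(\<Sum>j\<in>UNIV. h j - (x + b $ j) \<bullet> x) = 0"
    using hs by (simp add: sum_subtractf)
  moreover have "0 \<le> h j - (x + b $ j) \<bullet> x" for j
    using norm_cauchy_schwarz[of "x + b $ j" x] x by (simp add: h_def)
  ultimately have "\<forall>j\<in>UNIV. h j - (x + b $ j) \<bullet> x = 0"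
    by (subst (asm) sum_nonneg_eq_0_iff) auto
  then have "(x + b $ j) \<bullet> x = norm (x + b $ j) * norm x" for j
    using x by (simp add: h_def)
  then have par: "x + b $ j = h j *\<^sub>R x" for j
    unfolding norm_cauchy_schwarz_eq using x by (simp add: h_def)
  define v :: "real ^ 'm" where "v = (\<chi> j. h j - 1)"
  have bj: "b $ j = h j *\<^sub>R x - x" for j
    using par[of j] by (metis add_diff_cancel_left')
  have "v \<otimes>\<^sub>v x = b"
    by (subst vec_eq_iff) (simp add: tensor_def v_def bj scaleR_diff_left)
  moreover have "v \<in> V" using hs by (simp add: V_def v_def sum_subtractf)
  moreover have "x \<noteq> 0" using x by auto
  moreover have "- 1 \<le> v $ j" for j by (simp add: v_def h_def)
  ultimately have "v \<in> kappa_dom W"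
    using b(1) unfolding kappa_dom_def by blast
  then show ?thesis by (rule that) (simp add: v_def h_def)
qed

text \<open>Compactness turns the rigidity of the equality case into stability. On the compact set \<open>K\<close> of unit
vectors \<open>x\<close> and \<open>b \<in> W\<close> that grow at least by \<open>exp R\<close> in the norm of exponent \<open>1 / t\<close> and have
mean norm at most \<open>2\<close>, the mean norm is never equal to \<open>1\<close>, because in the equality case the growth is
at most \<open>exp (kappa W t) < exp R\<close>. So the mean norm is bounded away from \<open>1\<close> on \<open>K\<close>.\<close>

lemma flat_growth_unit_vector:
  fixes W :: "((real ^ 'l) ^ 'm) set"
  assumes W: "subspace W" "W \<subseteq> V_pow" and t: "0 < t" and R: "kappa W t < R"
  shows "\<exists>\<epsilon>>0. \<forall>x. \<forall>b\<in>W. norm x = 1 \<longrightarrow> avg (\<lambda>j. norm (x + b $ j)) \<le> 1 + \<epsilon> \<longrightarrow>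
           avg (\<lambda>j. norm (x + b $ j) powr (1 / t)) powr t \<le> exp R"
proof -
  define g :: "(real ^ 'l) \<times> ((real ^ 'l) ^ 'm) \<Rightarrow> real"
    where "g = (\<lambda>(x, b). avg (\<lambda>j. norm (x + b $ j)))"
  define h :: "(real ^ 'l) \<times> ((real ^ 'l) ^ 'm) \<Rightarrow> real"
    where "h = (\<lambda>(x, b). avg (\<lambda>j. norm (x + b $ j) powr (1 / t)) powr t)"
  define K where "K = (sphere 0 1 \<times> W) \<inter> {p. g p \<le> 2} \<inter> {p. exp R \<le> h p}"
  have cont_g: "continuous_on UNIV g"
    unfolding g_def avg_def case_prod_unfold by (intro continuous_intros) auto
  have cont_h: "continuous_on UNIV h"
    unfolding h_def avg_def case_prod_unfold using t
    by (intro continuous_intros continuous_on_powr') (auto intro!: divide_nonneg_nonneg sum_nonneg simp: sum_nonneg_eq_0_iff)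
  have closed: "closed K"
    unfolding K_def
    by (intro closed_Int closed_Times closed_Collect_le cont_g cont_h continuous_intros
        closed_subspace[OF W(1)]) auto
  have "bounded K"
  proof -
    have "norm p \<le> 1 + real CARD('m) * (1 + 2 * real CARD('m))" if "p \<in> K" for p
    proof -
      obtain x b where p: "p = (x, b)" by (cases p)
      have x: "norm x = 1" and "avg (\<lambda>j. norm (x + b $ j)) \<le> 2"
        using that by (auto simp: K_def p g_def)
      then have s: "(\<Sum>j\<in>UNIV. norm (x + b $ j)) \<le> 2 * real CARD('m)"
        by (simp add: avg_def field_simps)
      have "norm (b $ j) \<le> 1 + 2 * real CARD('m)" for j
      proof -
        have "norm (b $ j) \<le> norm (x + b $ j) + norm x"
          using norm_triangle_ineq4[of "x + b $ j" x] by simp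
        also have "norm (x + b $ j) \<le> (\<Sum>j\<in>UNIV. norm (x + b $ j))"
          by (rule member_le_sum) auto
        finally show ?thesis using s x by simp
      qed
      then have "(\<Sum>j\<in>UNIV. norm (b $ j)) \<le> (\<Sum>j\<in>(UNIV :: 'm set). 1 + 2 * real CARD('m))"
        by (intro sum_mono)
      moreover have "norm b \<le> (\<Sum>j\<in>UNIV. norm (b $ j))"
        unfolding norm_vec_def by (rule L2_set_le_sum) auto
      moreover have "norm p \<le> norm x + norm b"
        unfolding p by (rule norm_Pair_le)
      ultimately show ?thesis using x by simp
    qed
    then show ?thesis unfolding bounded_iff by blast
  qed
  with closed have compact: "compact K" by (simp add: compact_eq_bounded_closed)
  have pos: "1 < g p" if "p \<in> K" for p
  proof -
    obtain x b where p: "p = (x, b)" by (cases p)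
    have x: "norm x = 1" and b: "b \<in> W" and h: "exp R \<le> avg (\<lambda>j. norm (x + b $ j) powr (1 / t)) powr t"
      using that by (auto simp: K_def p h_def)
    have "1 \<le> avg (\<lambda>j. norm (x + b $ j))"
      using avg_norm_ge[of b x] b W x by auto
    moreover have "avg (\<lambda>j. norm (x + b $ j)) \<noteq> 1"
    proof
      assume eq: "avg (\<lambda>j. norm (x + b $ j)) = 1"
      obtain v where v: "v \<in> kappa_dom W" "\<And>j. norm (x + b $ j) = 1 + v $ j"
        using avg_norm_eq_imp_rank_one[OF b W(2) x eq] by blast
      have A: "avg (\<lambda>j. norm (x + b $ j) powr (1 / t))
          = (1 / real CARD('m)) * (\<Sum>j\<in>UNIV. \<bar>1 + v $ j\<bar> powr (1 / t))" (is "?A = ?B")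
        by (simp add: avg_def flip: v(2))
      have exp_ln: "y powr t = exp (t * ln y)" if "0 < y" for y :: real
        using that by (simp add: powr_def)
      have "?A powr t = exp (kappa_v v t)"
        using t unfolding A exp_ln[OF mean_powr_pos[OF v(1)]] by (simp add: kappa_v_def)
      also have "\<dots> < exp R"
        using kappa_v_le_kappa[OF t v(1)] R by simp
      finally show False using h by simp
    qed
    ultimately show ?thesis by (simp add: p g_def)
  qed
  have "\<exists>\<epsilon>>0. \<epsilon> \<le> 1 \<and> (\<forall>p\<in>K. 1 + \<epsilon> < g p)"
  proof (cases "K = {}")
    case False
    obtain p0 where p0: "p0 \<in> K" "\<And>p. p \<in> K \<Longrightarrow> g p0 \<le> g p"
      using continuous_attains_inf[OF compact False continuous_on_subset[OF cont_g]] by auto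
    \<comment> \<open>\<open>\<epsilon> \<le> 1\<close> keeps flat splittings within the bound \<open>g p \<le> 2\<close> that makes \<open>K\<close> bounded.\<close>
    define \<epsilon> where "\<epsilon> = min 1 ((g p0 - 1) / 2)"
    have "0 < \<epsilon>" "1 + \<epsilon> < g p0" using pos[OF p0(1)] by (auto simp: \<epsilon>_def min_def field_simps)
    then show ?thesis using p0(2) by (intro exI[of _ \<epsilon>]) (fastforce simp: \<epsilon>_def)
  qed (auto intro: exI[of _ 1])
  then obtain \<epsilon> where \<epsilon>: "0 < \<epsilon>" "\<epsilon> \<le> 1" "\<And>p. p \<in> K \<Longrightarrow> 1 + \<epsilon> < g p" by auto
  show ?thesis
  proof (intro exI[of _ \<epsilon>] conjI allI ballI impI)
    fix x :: "real ^ 'l" and b assume x: "norm x = 1" and b: "b \<in> W"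
      and flat: "avg (\<lambda>j. norm (x + b $ j)) \<le> 1 + \<epsilon>"
    have "(x, b) \<notin> K" using flat \<epsilon>(3)[of "(x, b)"] by (auto simp: g_def)
    then show "avg (\<lambda>j. norm (x + b $ j) powr (1 / t)) powr t \<le> exp R"
      using x b flat \<epsilon>(2) by (auto simp: K_def g_def h_def)
  qed (rule \<epsilon>(1))
qed

text \<open>By homogeneity the estimate passes from unit vectors to all \<open>x\<close>. For \<open>x = 0\<close> flatness means \<open>b = 0\<close>.\<close>

lemma flat_growth:
  fixes W :: "((real ^ 'l) ^ 'm) set"
  assumes W: "subspace W" "W \<subseteq> V_pow" and t: "0 < t" and R: "kappa W t < R"
  obtains \<epsilon> where "0 < \<epsilon>"
    "\<And>x b. b \<in> W \<Longrightarrow> avg (\<lambda>j. norm (x + b $ j)) \<le> (1 + \<epsilon>) * norm x \<Longrightarrow>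
       avg (\<lambda>j. norm (x + b $ j) powr (1 / t)) powr t \<le> exp R * norm x"
proof -
  obtain \<epsilon> where \<epsilon>: "0 < \<epsilon>"
    and unit: "\<And>x b. b \<in> W \<Longrightarrow> norm x = 1 \<Longrightarrow> avg (\<lambda>j. norm (x + b $ j)) \<le> 1 + \<epsilon> \<Longrightarrow>
           avg (\<lambda>j. norm (x + b $ j) powr (1 / t)) powr t \<le> exp R"
    using flat_growth_unit_vector[OF assms] by blast
  show ?thesis
  proof (rule that[OF \<epsilon>])
    fix x b assume b: "b \<in> W" and flat: "avg (\<lambda>j. norm (x + b $ j)) \<le> (1 + \<epsilon>) * norm x"
    show "avg (\<lambda>j. norm (x + b $ j) powr (1 / t)) powr t \<le> exp R * norm x"
    proof (cases "x = 0")
      case True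
      have "(\<Sum>j\<in>UNIV. norm (x + b $ j)) \<le> 0"
        using flat True by (simp add: avg_def field_simps)
      then have "(\<Sum>j\<in>UNIV. norm (x + b $ j)) = 0"
        by (meson antisym norm_ge_zero sum_nonneg)
      then have "\<forall>j\<in>UNIV. norm (x + b $ j) = 0"
        by (subst (asm) sum_nonneg_eq_0_iff) auto
      then show ?thesis by (simp add: avg_def)
    next
      case False
      define r where "r = norm x"
      have r: "0 < r" using False by (simp add: r_def)
      let ?y = "x /\<^sub>R r" and ?c = "b /\<^sub>R r"
      have sc: "norm (x + b $ j) = norm (?y + ?c $ j) * r" for j
      proof -
        have "x + b $ j = r *\<^sub>R (?y + ?c $ j)" using r by (simp add: scaleR_add_right)
        then show ?thesis using r by simp
      qed
      have "avg (\<lambda>j. norm (?y + ?c $ j)) * r \<le> (1 + \<epsilon>) * r"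
        using flat[folded r_def] unfolding avg_mult_right[symmetric] sc[symmetric] .
      then have flat': "avg (\<lambda>j. norm (?y + ?c $ j)) \<le> 1 + \<epsilon>" using r by simp
      have y1: "norm ?y = 1" using r by (simp add: r_def)
      have c: "?c \<in> W" using subspace_scale[OF W(1) b] .
      have "avg (\<lambda>j. norm (x + b $ j) powr (1 / t)) powr t
          = (avg (\<lambda>j. norm (?y + ?c $ j) powr (1 / t)) * r powr (1 / t)) powr t"
        unfolding sc using r by (simp only: powr_mult avg_mult_right norm_ge_zero less_imp_le)
      also have "\<dots> = avg (\<lambda>j. norm (?y + ?c $ j) powr (1 / t)) powr t * r"
      proof -
        have scale: "(a * r powr (1 / t)) powr t = a powr t * r" if "0 \<le> a" for a
          using that r t by (simp add: powr_mult powr_powr)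
        show ?thesis by (rule scale) (simp add: avg_def sum_nonneg)
      qed
      also have "\<dots> \<le> exp R * r"
        using unit[OF c y1 flat'] r by (intro mult_right_mono) auto
      finally show ?thesis by (simp add: r_def)
    qed
  qed
qed

text \<open>A vector \<open>x\<close> sits on an atom of \<open>\<nu>\<close>-measure \<open>C\<close>, and the vectors \<open>x + b $ j\<close> on children of
measure \<open>c j\<close>; \<open>K\<close> and \<open>m powr (\<alpha> - 1) * K\<close> are the Frostman bounds of the two levels.

If the splitting is flat, Hoelder's inequality separates norms from measures. The norms grow by at
most \<open>m powr t * exp R\<close>, and collecting the powers of \<open>m\<close> gives
\<open>- \<alpha> + t + (\<alpha> - 1) * t = - \<alpha> * (1 - t)\<close>.

If it is not flat, the children are estimated crudely by \<open>c j \<le> m powr (\<alpha> - 1) * K\<close>, which bounds the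
left side by \<open>K\<close> times the mean norm; and the mean norm is at most \<open>1 + 1 / \<epsilon>\<close> times its own increase.\<close>

lemma energy_step_single_split:
  fixes x :: "real ^ 'l" and b :: "(real ^ 'l) ^ 'm" and c :: "'m \<Rightarrow> real"
  defines "m \<equiv> real CARD('m)"
  assumes b: "b \<in> V_pow" and t: "0 < t" "t < 1" and \<epsilon>: "0 < \<epsilon>"
    and flat: "avg (\<lambda>j. norm (x + b $ j)) \<le> (1 + \<epsilon>) * norm x \<Longrightarrow>
       avg (\<lambda>j. norm (x + b $ j) powr (1 / t)) powr t \<le> exp R * norm x"
    and K: "0 < K" and c0: "\<And>j. 0 \<le> c j" and cK: "\<And>j. c j \<le> m powr (\<alpha> - 1) * K"
    and cs: "(\<Sum>j\<in>UNIV. c j) \<le> C"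
  shows "m powr (- \<alpha>) * (\<Sum>j\<in>UNIV. norm (x + b $ j) * c j powr (1 - t) * (m powr (\<alpha> - 1) * K) powr t)
    \<le> exp (R - \<alpha> * (1 - t) * ln m) * (norm x * C powr (1 - t) * K powr t)
      + (1 + 1 / \<epsilon>) * K * (avg (\<lambda>j. norm (x + b $ j)) - norm x)"
proof -
  have m: "0 < m" by (simp add: m_def)
  define L where "L = m powr (\<alpha> - 1) * K"
  have L: "0 < L" using K m by (simp add: L_def)
  have cL: "c j \<le> L" for j using cK by (simp add: L_def)
  have C0: "0 \<le> C" using cs c0 by (meson order_trans sum_nonneg)
  let ?E = "avg (\<lambda>j. norm (x + b $ j))"
  let ?S = "\<Sum>j\<in>UNIV. norm (x + b $ j) * c j powr (1 - t) * L powr t"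
  have E: "norm x \<le> ?E" by (rule avg_norm_ge[OF b])
  have "m powr (- \<alpha>) * ?S
    \<le> exp (R - \<alpha> * (1 - t) * ln m) * (norm x * C powr (1 - t) * K powr t)
      + (1 + 1 / \<epsilon>) * K * (?E - norm x)" (is "_ \<le> ?flatpart + ?convpart")
  proof (cases "?E \<le> (1 + \<epsilon>) * norm x")
    case True
    let ?P = "\<Sum>j\<in>UNIV. norm (x + b $ j) powr (1 / t)"
    have "?S = (\<Sum>j\<in>UNIV. norm (x + b $ j) * c j powr (1 - t)) * L powr t"
      by (simp add: sum_distrib_right)
    also have "\<dots> \<le> (?P powr t * (\<Sum>j\<in>UNIV. c j) powr (1 - t)) * L powr t"
      using t c0 by (intro mult_right_mono Holder_sum_powr) auto
    also have "\<dots> \<le> ((m powr t * (exp R * norm x)) * C powr (1 - t)) * L powr t"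
    proof (intro mult_right_mono mult_mono)
      let ?Q = "avg (\<lambda>j. norm (x + b $ j) powr (1 / t))"
      have "0 \<le> ?Q" by (simp add: avg_def sum_nonneg)
      moreover have "?P = m * ?Q"
        by (simp add: avg_def m_def)
      ultimately have "?P powr t = m powr t * ?Q powr t"
        using m powr_mult[of m ?Q t] by (simp only: less_imp_le)
      then show "?P powr t \<le> m powr t * (exp R * norm x)"
        using flat[OF True] m by simp
      show "(\<Sum>j\<in>UNIV. c j) powr (1 - t) \<le> C powr (1 - t)"
        using t c0 cs by (intro powr_mono2) (auto intro: sum_nonneg)
    qed auto
    finally have "m powr (- \<alpha>) * ?S
        \<le> m powr (- \<alpha>) * (((m powr t * (exp R * norm x)) * C powr (1 - t)) * L powr t)"
      by (intro mult_left_mono) auto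
    also have "\<dots> = (m powr (- \<alpha>) * m powr t * (m powr (\<alpha> - 1)) powr t * exp R)
        * (norm x * C powr (1 - t) * K powr t)"
      using K m by (simp add: L_def powr_mult)
    also have "m powr (- \<alpha>) * m powr t * (m powr (\<alpha> - 1)) powr t * exp R
        = exp (R - \<alpha> * (1 - t) * ln m)"
      using m by (simp add: powr_def flip: exp_add) (simp add: algebra_simps)
    also have "\<dots> * (norm x * C powr (1 - t) * K powr t) \<le> ?flatpart + ?convpart"
      using E K \<epsilon> by simp
    finally show ?thesis .
  next
    case False
    have "?S \<le> (\<Sum>j\<in>UNIV. norm (x + b $ j) * L)"
    proof (rule sum_mono)
      fix j
      have "norm (x + b $ j) * c j powr (1 - t) * L powr t
          \<le> norm (x + b $ j) * L powr (1 - t) * L powr t"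
        using t c0 cL by (intro mult_right_mono mult_left_mono powr_mono2) auto
      also have "\<dots> = norm (x + b $ j) * L"
        using L by (simp add: mult.assoc flip: powr_add)
      finally show "norm (x + b $ j) * c j powr (1 - t) * L powr t \<le> norm (x + b $ j) * L" .
    qed
    also have "\<dots> = m * L * ?E"
      by (simp add: avg_def m_def flip: sum_distrib_right)
    finally have "m powr (- \<alpha>) * ?S \<le> m powr (- \<alpha>) * (m * L * ?E)"
      by (intro mult_left_mono) auto
    also have "\<dots> = (m powr (- \<alpha>) * m powr 1 * m powr (\<alpha> - 1)) * K * ?E"
      using m by (simp add: L_def)
    also have "m powr (- \<alpha>) * m powr 1 * m powr (\<alpha> - 1) = 1"
      using m by (simp only: powr_add[symmetric]) simp
    also have "1 * K * ?E \<le> K * ((1 + 1 / \<epsilon>) * (?E - norm x))"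
    proof -
      have "\<epsilon> * norm x \<le> ?E - norm x" using False by (simp add: algebra_simps)
      then have "?E \<le> (1 + 1 / \<epsilon>) * (?E - norm x)"
        using \<epsilon> by (simp add: field_simps)
      then show ?thesis using K by simp
    qed
    also have "\<dots> = ?convpart" by simp
    also have "\<dots> \<le> ?flatpart + ?convpart" by simp
    finally show ?thesis .
  qed
  then show ?thesis by (simp only: L_def)
qed

section \<open>Piecewise constant functions and series in the mean\<close>

lemma has_bochner_integral_partition:
  fixes g :: "'i \<Rightarrow> 'b :: {banach, second_countable_topology}"
  assumes N: "finite_measure N" and fin: "finite I" and A: "\<And>i. i \<in> I \<Longrightarrow> A i \<in> sets N"
    and disj: "disjoint_family_on A I" and cover: "space N \<subseteq> (\<Union>i\<in>I. A i)"
    and f: "\<And>i x. i \<in> I \<Longrightarrow> x \<in> A i \<Longrightarrow> f x = g i"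
  shows "has_bochner_integral N f (\<Sum>i\<in>I. measure N (A i) *\<^sub>R g i)"
proof -
  interpret finite_measure N by (rule N)
  have "has_bochner_integral N (\<lambda>x. \<Sum>i\<in>I. indicator (A i) x *\<^sub>R g i) (\<Sum>i\<in>I. measure N (A i) *\<^sub>R g i)"
    by (intro has_bochner_integral_sum has_bochner_integral_scaleR_left has_bochner_integral_real_indicator A)
      (simp_all add: emeasure_eq_measure)
  moreover have "f x = (\<Sum>i\<in>I. indicator (A i) x *\<^sub>R g i)" if x: "x \<in> space N" for x
  proof -
    obtain i where i: "i \<in> I" "x \<in> A i" using cover x by auto
    then have "indicator (A k) x *\<^sub>R g k = (if k = i then g i else 0)" if "k \<in> I" for k
      using disj that unfolding disjoint_family_on_def by (auto simp: indicator_def)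
    then have "(\<Sum>k\<in>I. indicator (A k) x *\<^sub>R g k) = (\<Sum>k\<in>I. if k = i then g i else 0)"
      by (intro sum.cong) auto
    then show ?thesis using fin i f by simp
  qed
  ultimately show ?thesis
    by (subst has_bochner_integral_cong[OF refl _ refl]) auto
qed

text \<open>Absolute convergence in the mean: the sum of the norms is integrable, hence finite almost
everywhere, and dominates the partial sums.\<close>

lemma L1_converges_series:
  fixes h :: "nat \<Rightarrow> 'b \<Rightarrow> real ^ 'l"
  assumes int[measurable]: "\<And>n. integrable \<nu> (h n)"
    and sm: "summable (\<lambda>n. LINT x|\<nu>. norm (h n x))"
  shows "L1_converges \<nu> (\<lambda>N x. \<Sum>n<N. h n x) (\<lambda>x. \<Sum>n. h n x)"
    and "(LINT x|\<nu>. norm (\<Sum>n. h n x)) \<le> (\<Sum>n. LINT x|\<nu>. norm (h n x))"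
proof -
  have nn: "0 \<le> (LINT x|\<nu>. norm (h n x))" for n by (rule integral_nonneg_AE) auto
  have meas[measurable]: "h n \<in> borel_measurable \<nu>" for n using int by auto
  have "(\<integral>\<^sup>+x. (\<Sum>n. ennreal (norm (h n x))) \<partial>\<nu>) = (\<Sum>n. \<integral>\<^sup>+x. ennreal (norm (h n x)) \<partial>\<nu>)"
    by (rule nn_integral_suminf) auto
  also have "\<dots> = (\<Sum>n. ennreal (LINT x|\<nu>. norm (h n x)))"
    by (intro suminf_cong nn_integral_eq_integral) (auto intro: Bochner_Integration.integrable_norm int)
  also have "\<dots> = ennreal (\<Sum>n. LINT x|\<nu>. norm (h n x))"
    by (rule suminf_ennreal2[OF nn sm])
  finally have "(\<integral>\<^sup>+x. (\<Sum>n. ennreal (norm (h n x))) \<partial>\<nu>) \<noteq> \<infinity>" by simp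
  then have "AE x in \<nu>. (\<Sum>n. ennreal (norm (h n x))) \<noteq> \<infinity>"
    by (intro nn_integral_PInf_AE) auto
  then have AE: "AE x in \<nu>. summable (\<lambda>n. norm (h n x))"
    by eventually_elim (auto intro: summable_suminf_not_top)
  then have AE': "AE x in \<nu>. summable (\<lambda>n. norm (norm (h n x)))" by simp
  have sm': "summable (\<lambda>n. LINT x|\<nu>. norm (norm (h n x)))" using sm by simp
  define w where "w x = (\<Sum>n. norm (h n x))" for x
  have w: "integrable \<nu> w"
    unfolding w_def by (rule integrable_suminf[OF Bochner_Integration.integrable_norm[OF int] AE' sm'])
  have intw: "(LINT x|\<nu>. w x) = (\<Sum>n. LINT x|\<nu>. norm (h n x))"
    unfolding w_def by (rule integral_suminf[OF Bochner_Integration.integrable_norm[OF int] AE' sm'])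
  define G where "G x = (\<Sum>n. h n x)" for x
  have G: "integrable \<nu> G"
    unfolding G_def by (rule integrable_suminf[OF int AE sm])
  have G_le: "AE x in \<nu>. norm (G x) \<le> w x"
    using AE by eventually_elim (auto simp: G_def w_def intro: summable_norm)
  have S: "integrable \<nu> (\<lambda>x. \<Sum>n<N. h n x)" for N
    by (intro Bochner_Integration.integrable_sum int)
  have "(\<lambda>N. LINT x|\<nu>. norm ((\<Sum>n<N. h n x) - G x)) \<longlonglongrightarrow> (LINT x|\<nu>. 0)"
  proof (rule integral_dominated_convergence)
    show "integrable \<nu> (\<lambda>x. 2 * w x)" using w by simp
    show "AE x in \<nu>. (\<lambda>N. norm ((\<Sum>n<N. h n x) - G x)) \<longlonglongrightarrow> 0"
      using AE
    proof eventually_elim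
      fix x assume "summable (\<lambda>n. norm (h n x))"
      then have "(\<lambda>n. h n x) sums G x"
        unfolding G_def by (rule summable_sums[OF summable_norm_cancel])
      then have "(\<lambda>N. (\<Sum>n<N. h n x) - G x) \<longlonglongrightarrow> 0"
        unfolding sums_def by (rule LIM_zero)
      then show "(\<lambda>N. norm ((\<Sum>n<N. h n x) - G x)) \<longlonglongrightarrow> 0"
        by (rule tendsto_norm_zero)
    qed
    fix N
    show "AE x in \<nu>. norm (norm ((\<Sum>n<N. h n x) - G x)) \<le> 2 * w x"
      using AE G_le
    proof eventually_elim
      fix x assume sx: "summable (\<lambda>n. norm (h n x))" and Gx: "norm (G x) \<le> w x"
      have "norm (\<Sum>n<N. h n x) \<le> (\<Sum>n<N. norm (h n x))" by (rule norm_sum)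
      also have "\<dots> \<le> w x"
        unfolding w_def by (rule sum_le_suminf[OF sx]) auto
      finally show "norm (norm ((\<Sum>n<N. h n x) - G x)) \<le> 2 * w x"
        using Gx norm_triangle_ineq4[of "\<Sum>n<N. h n x" "G x"] by simp
    qed
  qed (use G in auto)
  then show "L1_converges \<nu> (\<lambda>N x. \<Sum>n<N. h n x) (\<lambda>x. \<Sum>n. h n x)"
    unfolding L1_converges_def G_def[symmetric] using S G by simp
  show "(LINT x|\<nu>. norm (\<Sum>n. h n x)) \<le> (\<Sum>n. LINT x|\<nu>. norm (h n x))"
    unfolding intw[symmetric] G_def[symmetric]
    by (rule integral_mono_AE[OF Bochner_Integration.integrable_norm[OF G] w G_le])
qed

section \<open>The tree of atoms\<close>

lemma atoms_subset: "\<omega> \<in> atoms A \<Longrightarrow> \<omega> \<in> A"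
  by (simp add: atoms_def)

lemma atoms_nonempty: "\<omega> \<in> atoms A \<Longrightarrow> \<omega> \<noteq> {}"
  by (simp add: atoms_def)

lemma (in algebra) atom_subset_of_meets:
  assumes "\<omega> \<in> atoms M" "B \<in> M" "\<omega> \<inter> B \<noteq> {}"
  shows "\<omega> \<subseteq> B"
proof -
  have "\<omega> \<inter> B \<in> M" using assms by (auto simp: atoms_def)
  then have "\<omega> \<inter> B = \<omega>" using assms by (auto simp: atoms_def)
  then show ?thesis by blast
qed

lemma (in algebra) atoms_eq_of_meet:
  assumes "\<omega> \<in> atoms M" "\<omega>' \<in> atoms M" "\<omega> \<inter> \<omega>' \<noteq> {}"
  shows "\<omega> = \<omega>'"
  using assms atom_subset_of_meets[of \<omega> \<omega>'] atom_subset_of_meets[of \<omega>' \<omega>] atoms_subset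
  by (metis Int_commute subset_antisym)

text \<open>A minimal member of the algebra containing \<open>x\<close> is an atom: a subset of it in the algebra or its
relative complement contains \<open>x\<close>.\<close>

lemma (in algebra) finite_algebra_atom_exists:
  assumes fin: "finite M" and B: "B \<in> M" and x: "x \<in> B"
  obtains \<omega> where "\<omega> \<in> atoms M" "x \<in> \<omega>" "\<omega> \<subseteq> B"
proof -
  obtain \<omega> where \<omega>: "\<omega> \<in> M" "x \<in> \<omega>" "\<omega> \<subseteq> B"
    and min: "\<And>C. C \<in> M \<Longrightarrow> x \<in> C \<Longrightarrow> C \<subseteq> \<omega> \<Longrightarrow> C = \<omega>"
    using finite_has_minimal2[of "{C \<in> M. x \<in> C}" B] fin B x by auto
  have "C = {} \<or> C = \<omega>" if "C \<in> M" "C \<subseteq> \<omega>" for C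
  proof (cases "x \<in> C")
    case False
    then have "\<omega> - C = \<omega>" using \<omega> that by (intro min) auto
    then show ?thesis using that by blast
  qed (use min that in blast)
  then have "\<omega> \<in> atoms M" using \<omega> by (auto simp: atoms_def)
  then show ?thesis using that \<omega> by blast
qed

locale uniform_tree =
  fixes M :: "'a measure" and \<F> :: "nat \<Rightarrow> 'a set set" and J :: "'a set \<Rightarrow> 'm::finite \<Rightarrow> 'a set"
  assumes filtration: "uniform_filtration CARD('m) M \<F>"
    and labelling: "children_labelling \<F> J"
begin

lemma prob_M: "prob_space M"
  using filtration by (simp add: uniform_filtration_def)

sublocale prob_space M by (rule prob_M)

lemma algebra_F: "algebra (space M) (\<F> n)"
  and finite_F: "finite (\<F> n)"
  and F_sets: "\<F> n \<subseteq> sets M"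
  and F_Suc: "\<F> n \<subseteq> \<F> (Suc n)"
  using filtration by (auto simp: uniform_filtration_def)

lemma finite_atoms: "finite (atoms (\<F> n))"
  using finite_F[of n] by (auto simp: atoms_def)

lemma atom_sets: "\<omega> \<in> atoms (\<F> n) \<Longrightarrow> \<omega> \<in> sets M"
  using F_sets atoms_subset by blast

lemma atoms_cover: "space M \<subseteq> \<Union> (atoms (\<F> n))"
proof
  fix x assume "x \<in> space M"
  moreover have "space M \<in> \<F> n" using algebra.top[OF algebra_F] .
  ultimately obtain \<omega> where "\<omega> \<in> atoms (\<F> n)" "x \<in> \<omega>"
    using algebra.finite_algebra_atom_exists[OF algebra_F finite_F] by metis
  then show "x \<in> \<Union> (atoms (\<F> n))" by blast
qed

lemma child:
  assumes "\<omega> \<in> atoms (\<F> n)"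
  shows "J \<omega> j \<in> atoms (\<F> (Suc n))" "J \<omega> j \<subseteq> \<omega>"
proof -
  have "J \<omega> j \<in> children \<F> n \<omega>"
    using labelling assms unfolding children_labelling_def bij_betw_def by blast
  then show "J \<omega> j \<in> atoms (\<F> (Suc n))" "J \<omega> j \<subseteq> \<omega>"
    by (auto simp: children_def)
qed

lemma child_of:
  assumes "\<omega> \<in> atoms (\<F> n)" "\<omega>' \<in> children \<F> n \<omega>"
  obtains j where "\<omega>' = J \<omega> j"
  using labelling assms that unfolding children_labelling_def bij_betw_def by blast

lemma child_inj: "\<omega> \<in> atoms (\<F> n) \<Longrightarrow> inj (J \<omega>)"
  using labelling unfolding children_labelling_def bij_betw_def by blast

lemma children_disjoint: "\<omega> \<in> atoms (\<F> n) \<Longrightarrow> disjoint_family (J \<omega>)"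
  unfolding disjoint_family_on_def
  using algebra.atoms_eq_of_meet[OF algebra_F] child(1) child_inj by (metis injD)

lemma children_cover:
  assumes "\<omega> \<in> atoms (\<F> n)"
  shows "(\<Union>j. J \<omega> j) = \<omega>"
proof
  show "(\<Union>j. J \<omega> j) \<subseteq> \<omega>" using child(2)[OF assms] by blast
  show "\<omega> \<subseteq> (\<Union>j. J \<omega> j)"
  proof
    fix x assume x: "x \<in> \<omega>"
    have "\<omega> \<in> \<F> (Suc n)" using F_Suc assms atoms_subset by blast
    then obtain \<omega>' where "\<omega>' \<in> atoms (\<F> (Suc n))" "x \<in> \<omega>'" "\<omega>' \<subseteq> \<omega>"
      using x algebra.finite_algebra_atom_exists[OF algebra_F finite_F] by metis
    then have "\<omega>' \<in> children \<F> n \<omega>" by (simp add: children_def)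
    then obtain j where "\<omega>' = J \<omega> j" using child_of[OF assms] by blast
    with \<open>x \<in> \<omega>'\<close> show "x \<in> (\<Union>j. J \<omega> j)" by blast
  qed
qed

text \<open>Every atom of level \<open>Suc n\<close> is a child of exactly one atom of level \<open>n\<close>, so sums over a level can be
taken splitting by splitting.\<close>

lemma bij_betw_children:
  "bij_betw (\<lambda>(\<omega>, j). J \<omega> j) (atoms (\<F> n) \<times> UNIV) (atoms (\<F> (Suc n)))"
proof (rule bij_betwI')
  fix p q :: "'a set \<times> 'm"
  assume p: "p \<in> atoms (\<F> n) \<times> UNIV" and q: "q \<in> atoms (\<F> n) \<times> UNIV"
  obtain \<omega> j \<omega>' j' where pq: "p = (\<omega>, j)" "q = (\<omega>', j')" by (metis surj_pair)
  have at: "\<omega> \<in> atoms (\<F> n)" "\<omega>' \<in> atoms (\<F> n)" using p q pq by auto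
  have "\<omega> = \<omega>' \<and> j = j'" if eq: "J \<omega> j = J \<omega>' j'"
  proof -
    have "J \<omega> j \<noteq> {}" using child(1)[OF at(1)] atoms_nonempty by blast
    then have "\<omega> \<inter> \<omega>' \<noteq> {}" using child(2)[OF at(1), of j] child(2)[OF at(2), of j'] eq by blast
    then have "\<omega> = \<omega>'" by (rule algebra.atoms_eq_of_meet[OF algebra_F at])
    then show ?thesis using eq child_inj[OF at(1)] by (auto dest: injD)
  qed
  then show "((case p of (\<omega>, j) \<Rightarrow> J \<omega> j) = (case q of (\<omega>, j) \<Rightarrow> J \<omega> j)) = (p = q)"
    by (auto simp: pq)
next
  fix p :: "'a set \<times> 'm" assume "p \<in> atoms (\<F> n) \<times> UNIV"
  then show "(case p of (\<omega>, j) \<Rightarrow> J \<omega> j) \<in> atoms (\<F> (Suc n))" using child(1) by auto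
next
  fix \<omega>' assume \<omega>': "\<omega>' \<in> atoms (\<F> (Suc n))"
  then obtain x where x: "x \<in> \<omega>'" using atoms_nonempty by blast
  then have "x \<in> space M" using atom_sets[OF \<omega>'] sets.sets_into_space by blast
  then obtain \<omega> where \<omega>: "\<omega> \<in> atoms (\<F> n)" "x \<in> \<omega>" using atoms_cover by blast
  then have "\<omega> \<in> \<F> (Suc n)" using F_Suc atoms_subset by blast
  then have "\<omega>' \<subseteq> \<omega>"
    using x \<omega> by (intro algebra.atom_subset_of_meets[OF algebra_F \<omega>']) auto
  then have "\<omega>' \<in> children \<F> n \<omega>" using \<omega>' by (simp add: children_def)
  then obtain j where "\<omega>' = J \<omega> j" using child_of[OF \<omega>(1)] by blast
  then show "\<exists>p\<in>atoms (\<F> n) \<times> UNIV. \<omega>' = (case p of (\<omega>, j) \<Rightarrow> J \<omega> j)"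
    using \<omega>(1) by (intro bexI[of _ "(\<omega>, j)"]) auto
qed

lemma sum_atoms_Suc:
  "(\<Sum>\<omega>\<in>atoms (\<F> (Suc n)). h \<omega>) = (\<Sum>\<omega>\<in>atoms (\<F> n). \<Sum>j\<in>UNIV. h (J \<omega> j))"
  unfolding sum.reindex_bij_betw[OF bij_betw_children, symmetric] sum.cartesian_product
  by (simp add: case_prod_unfold)

lemma atoms_0: "atoms (\<F> 0) = {space M}"
  using filtration not_empty by (auto simp: uniform_filtration_def atoms_def)

lemma children_equal_measure:
  assumes "\<omega> \<in> atoms (\<F> n)" "\<omega>' \<in> children \<F> n \<omega>" "\<omega>'' \<in> children \<F> n \<omega>"
  shows "measure M \<omega>' = measure M \<omega>''"
proof -
  have "\<forall>n. \<forall>\<omega>\<in>atoms (\<F> n). card (children \<F> n \<omega>) = CARD('m) \<and>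
      (\<forall>\<omega>'\<in>children \<F> n \<omega>. \<forall>\<omega>''\<in>children \<F> n \<omega>. measure M \<omega>' = measure M \<omega>'')"
    using filtration unfolding uniform_filtration_def by (elim conjE)
  then show ?thesis using assms by blast
qed

lemma measure_atom: "\<omega> \<in> atoms (\<F> n) \<Longrightarrow> measure M \<omega> = 1 / real CARD('m) ^ n"
proof (induction n arbitrary: \<omega>)
  case 0
  then show ?case by (simp add: atoms_0 prob_space)
next
  case (Suc n)
  have "\<omega> \<in> (\<lambda>(\<omega>, j). J \<omega> j) ` (atoms (\<F> n) \<times> UNIV)"
    using Suc.prems bij_betw_children[of n] by (simp add: bij_betw_def)
  then obtain \<eta> j where \<eta>: "\<eta> \<in> atoms (\<F> n)" "\<omega> = J \<eta> j" by auto
  have "J \<eta> k \<in> children \<F> n \<eta>" for k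
    using child[OF \<eta>(1)] by (simp add: children_def)
  then have eq: "measure M (J \<eta> i) = measure M \<omega>" for i
    unfolding \<eta>(2) by (intro children_equal_measure[OF \<eta>(1)])
  have "measure M (\<Union>i. J \<eta> i) = (\<Sum>i\<in>UNIV. measure M (J \<eta> i))"
    using atom_sets[OF child(1)[OF \<eta>(1)]] children_disjoint[OF \<eta>(1)]
    by (intro finite_measure_finite_Union) auto
  then have "1 / real CARD('m) ^ n = real CARD('m) * measure M \<omega>"
    using Suc.IH[OF \<eta>(1)] by (simp add: children_cover[OF \<eta>(1)] eq)
  then show ?case by (simp add: field_simps)
qed

text \<open>A finite algebra is a \<open>\<sigma>\<close>-algebra, so the fibre of \<open>f\<close> through \<open>y\<close> belongs to \<open>\<F> n\<close> and contains
the whole atom.\<close>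

lemma adapted_const_on_atom:
  fixes f :: "'a \<Rightarrow> real ^ 'l"
  assumes f: "f \<in> borel_measurable (sigma (space M) (\<F> n))"
    and \<omega>: "\<omega> \<in> atoms (\<F> n)" and xy: "x \<in> \<omega>" "y \<in> \<omega>"
  shows "f x = f y"
proof -
  have sub: "\<F> n \<subseteq> Pow (space M)"
    using F_sets sets.sets_into_space by blast
  have "sigma_sets (space M) (\<F> n) = \<F> n"
    using sigma_algebra.sigma_sets_eq[OF algebra.is_sigma_algebra[OF algebra_F finite_F]] .
  moreover have "f -` {f y} \<inter> space (sigma (space M) (\<F> n)) \<in> sets (sigma (space M) (\<F> n))"
    by (rule measurable_sets[OF f]) simp
  ultimately have "f -` {f y} \<inter> space M \<in> \<F> n"
    using sub by simp
  moreover have "y \<in> \<omega> \<inter> (f -` {f y} \<inter> space M)"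
    using xy \<omega> sub atoms_subset by blast
  ultimately have "\<omega> \<subseteq> f -` {f y} \<inter> space M"
    by (intro algebra.atom_subset_of_meets[OF algebra_F \<omega>]) auto
  then show ?thesis using xy by blast
qed

end

definition atom_value :: "('a \<Rightarrow> 'b) \<Rightarrow> 'a set \<Rightarrow> 'b" where
  "atom_value f \<omega> = f (SOME x. x \<in> \<omega>)"

lemma on_paths_atom_value: "on_paths n f \<gamma> = atom_value f (\<gamma> n)"
  by (simp add: on_paths_def atom_value_def)

context uniform_tree
begin

lemma atom_value_eq:
  fixes f :: "'a \<Rightarrow> real ^ 'l"
  assumes f: "f \<in> borel_measurable (sigma (space M) (\<F> n))"
    and \<omega>: "\<omega> \<in> atoms (\<F> n)" and x: "x \<in> \<omega>"
  shows "atom_value f \<omega> = f x"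
  unfolding atom_value_def
  by (rule adapted_const_on_atom[OF f \<omega> someI[of "\<lambda>x. x \<in> \<omega>", OF x] x])

lemma integral_norm_adapted:
  fixes f :: "'a \<Rightarrow> real ^ 'l"
  assumes f: "f \<in> borel_measurable (sigma (space M) (\<F> n))"
  shows "(LINT x|M. norm (f x))
           = (\<Sum>\<omega>\<in>atoms (\<F> n). norm (atom_value f \<omega>)) / real CARD('m) ^ n"
proof -
  have "has_bochner_integral M (\<lambda>x. norm (f x))
      (\<Sum>\<omega>\<in>atoms (\<F> n). measure M \<omega> *\<^sub>R norm (atom_value f \<omega>))"
  proof (rule has_bochner_integral_partition)
    show "disjoint_family_on (\<lambda>\<omega>. \<omega>) (atoms (\<F> n))"
      using algebra.atoms_eq_of_meet[OF algebra_F] by (auto simp: disjoint_family_on_def)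
    show "norm (f x) = norm (atom_value f \<omega>)" if "\<omega> \<in> atoms (\<F> n)" "x \<in> \<omega>" for \<omega> x
      by (simp add: atom_value_eq[OF f that])
  qed (use atom_sets finite_atoms atoms_cover in \<open>auto intro: finite_measure_axioms\<close>)
  then show ?thesis
    by (simp add: has_bochner_integral_iff measure_atom sum_divide_distrib)
qed

end

section \<open>The energy of a martingale\<close>

text \<open>Summing the recursion over \<open>n\<close> telescopes the increments of \<open>E\<close>, and the contraction absorbs
\<open>\<rho>\<close> times the sum into the left side.\<close>

lemma sum_bounded_of_contraction:
  fixes U E :: "nat \<Rightarrow> real"
  assumes U: "\<And>n. 0 \<le> U n" and E: "0 \<le> E 0" "\<And>n. E n \<le> B"
    and \<rho>: "\<rho> < 1" and D: "0 \<le> D" and U0: "U 0 \<le> C * B"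
    and step: "\<And>n. U (Suc n) \<le> \<rho> * U n + D * (E (Suc n) - E n)"
  shows "(\<Sum>n<N. U n) \<le> (C + D) * B / (1 - \<rho>)"
proof -
  have "(\<Sum>n<N. U n) + U N = U 0 + (\<Sum>n<N. U (Suc n))"
    using sum.lessThan_Suc[of U N] sum.lessThan_Suc_shift[of U N] by simp
  also have "(\<Sum>n<N. U (Suc n)) \<le> (\<Sum>n<N. \<rho> * U n + D * (E (Suc n) - E n))"
    by (intro sum_mono step)
  also have "\<dots> = \<rho> * (\<Sum>n<N. U n) + D * (E N - E 0)"
    by (simp only: sum.distrib flip: sum_distrib_left sum_lessThan_telescope)
  also have "D * (E N - E 0) \<le> D * B"
    using D E(1) E(2)[of N] by (intro mult_left_mono) auto
  finally have "(1 - \<rho>) * (\<Sum>n<N. U n) \<le> (C + D) * B"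
    using U[of N] U0 by (simp add: algebra_simps)
  then show ?thesis using \<rho> by (simp add: field_simps)
qed

locale frostman_tree = uniform_tree M \<F> J
  for M :: "'a measure" and \<F> :: "nat \<Rightarrow> 'a set set" and J :: "'a set \<Rightarrow> 'm::finite \<Rightarrow> 'a set" +
  fixes \<nu> :: "(nat \<Rightarrow> 'a set) measure" and \<alpha> C :: real
  assumes m2: "2 \<le> CARD('m)"
    and borel_nu: "finite_borel_measure_on_paths CARD('m) \<F> \<nu>"
    and C_pos: "0 < C"
    and frostman_bound: "\<And>n \<omega>. \<omega> \<in> atoms (\<F> n) \<Longrightarrow>
      measure \<nu> (cylinder \<F> n \<omega>) \<le> C * real CARD('m) powr ((\<alpha> - 1) * real n)"
begin

lemma finite_measure_nu: "finite_measure \<nu>"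
  and space_nu: "space \<nu> = paths \<F>"
  using borel_nu by (auto simp: finite_borel_measure_on_paths_def)

text \<open>A cylinder of level \<open>n\<close> is open, as it contains with each path the ball of radius \<open>1 / m ^ Suc n\<close>:
paths at most that far apart agree at all indices below \<open>Suc n\<close>, hence at \<open>n\<close>.\<close>

lemma cylinder_sets: "cylinder \<F> n \<omega> \<in> sets \<nu>"
proof -
  interpret Metric_space "paths \<F>" "path_dist CARD('m)"
    by (rule Metric_space_path_dist[OF m2])
  have "openin mtopology (cylinder \<F> n \<omega>)"
    unfolding openin_mtopology
  proof (intro conjI allI impI)
    show "cylinder \<F> n \<omega> \<subseteq> paths \<F>" by (auto simp: cylinder_def)
    fix \<gamma> assume \<gamma>: "\<gamma> \<in> cylinder \<F> n \<omega>"
    have "mball \<gamma> (1 / real CARD('m) ^ Suc n) \<subseteq> cylinder \<F> n \<omega>"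
    proof
      fix \<gamma>' assume "\<gamma>' \<in> mball \<gamma> (1 / real CARD('m) ^ Suc n)"
      then have p: "\<gamma>' \<in> paths \<F>" and d: "path_dist CARD('m) \<gamma> \<gamma>' \<le> 1 / real CARD('m) ^ Suc n"
        by auto
      have "\<forall>j<Suc n. \<gamma> j = \<gamma>' j"
        using d by (simp only: path_dist_le_iff[OF m2])
      then have "\<gamma>' n = \<gamma> n" by simp
      then show "\<gamma>' \<in> cylinder \<F> n \<omega>" using \<gamma> p by (simp add: cylinder_def)
    qed
    moreover have "0 < 1 / real CARD('m) ^ Suc n" by simp
    ultimately show "\<exists>r>0. mball \<gamma> r \<subseteq> cylinder \<F> n \<omega>" by blast
  qed
  then show ?thesis
    using borel_nu by (auto simp: finite_borel_measure_on_paths_def)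
qed

lemma path_in_atoms: "\<gamma> \<in> paths \<F> \<Longrightarrow> \<gamma> n \<in> atoms (\<F> n)"
  and path_in_children: "\<gamma> \<in> paths \<F> \<Longrightarrow> \<gamma> (Suc n) \<in> children \<F> n (\<gamma> n)"
  by (auto simp: paths_def)

lemma has_integral_on_paths:
  fixes g :: "'a set \<Rightarrow> 'b :: {banach, second_countable_topology}"
  shows "has_bochner_integral \<nu> (\<lambda>\<gamma>. g (\<gamma> n))
           (\<Sum>\<omega>\<in>atoms (\<F> n). measure \<nu> (cylinder \<F> n \<omega>) *\<^sub>R g \<omega>)"
proof (rule has_bochner_integral_partition[OF finite_measure_nu finite_atoms cylinder_sets])
  show "disjoint_family_on (cylinder \<F> n) (atoms (\<F> n))"
    by (auto simp: disjoint_family_on_def cylinder_def)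
  show "space \<nu> \<subseteq> (\<Union>\<omega>\<in>atoms (\<F> n). cylinder \<F> n \<omega>)"
    using path_in_atoms by (auto simp: space_nu cylinder_def)
qed (simp add: cylinder_def)

lemma sum_measure_children_le:
  assumes \<omega>: "\<omega> \<in> atoms (\<F> n)"
  shows "(\<Sum>j\<in>UNIV. measure \<nu> (cylinder \<F> (Suc n) (J \<omega> j))) \<le> measure \<nu> (cylinder \<F> n \<omega>)"
proof -
  interpret nu: finite_measure \<nu> by (rule finite_measure_nu)
  have "(\<Sum>j\<in>UNIV. measure \<nu> (cylinder \<F> (Suc n) (J \<omega> j)))
      = measure \<nu> (\<Union>j. cylinder \<F> (Suc n) (J \<omega> j))"
  proof (rule nu.finite_measure_finite_Union[symmetric])
    show "disjoint_family (\<lambda>j. cylinder \<F> (Suc n) (J \<omega> j))"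
      using child_inj[OF \<omega>] by (auto simp: disjoint_family_on_def cylinder_def dest: injD)
  qed (use cylinder_sets in auto)
  also have "\<dots> \<le> measure \<nu> (cylinder \<F> n \<omega>)"
  proof (intro nu.finite_measure_mono cylinder_sets subsetI)
    fix \<gamma> assume "\<gamma> \<in> (\<Union>j. cylinder \<F> (Suc n) (J \<omega> j))"
    then obtain j where \<gamma>: "\<gamma> \<in> paths \<F>" "\<gamma> (Suc n) = J \<omega> j" by (auto simp: cylinder_def)
    have "J \<omega> j \<subseteq> \<gamma> n" using path_in_children[OF \<gamma>(1), of n] \<gamma>(2) by (simp add: children_def)
    moreover have "J \<omega> j \<noteq> {}" "J \<omega> j \<subseteq> \<omega>"
      using child[OF \<omega>] atoms_nonempty by blast+
    ultimately have "\<gamma> n \<inter> \<omega> \<noteq> {}" by blast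
    then have "\<gamma> n = \<omega>"
      by (rule algebra.atoms_eq_of_meet[OF algebra_F path_in_atoms[OF \<gamma>(1)] \<omega>])
    then show "\<gamma> \<in> cylinder \<F> n \<omega>" using \<gamma>(1) by (simp add: cylinder_def)
  qed
  finally show ?thesis .
qed

definition K :: "nat \<Rightarrow> real" where
  "K n = C * real CARD('m) powr ((\<alpha> - 1) * real n)"

lemma K_pos: "0 < K n"
  using C_pos by (simp add: K_def)

lemma K_Suc: "K (Suc n) = real CARD('m) powr (\<alpha> - 1) * K n"
proof -
  have "(\<alpha> - 1) * real (Suc n) = (\<alpha> - 1) + (\<alpha> - 1) * real n" by (simp add: algebra_simps)
  then show ?thesis unfolding K_def by (simp only: powr_add mult_ac)
qed

lemma weight_K: "real CARD('m) powr (- \<alpha> * real n) * K n = C / real CARD('m) ^ n"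
proof -
  have "real CARD('m) powr (- \<alpha> * real n) * real CARD('m) powr ((\<alpha> - 1) * real n) = real CARD('m) powr (- real n)"
    unfolding powr_add[symmetric] by (simp add: algebra_simps)
  then show ?thesis
    by (simp add: K_def powr_minus powr_realpow divide_inverse mult.left_commute)
qed

lemma measure_le_K: "\<omega> \<in> atoms (\<F> n) \<Longrightarrow> measure \<nu> (cylinder \<F> n \<omega>) \<le> K n"
  using frostman_bound by (simp add: K_def)

text \<open>The factor \<open>\<nu>(\<omega>) powr (1 - t) * K n powr t\<close> replaces \<open>\<nu>(\<omega>)\<close> by a geometric mean with its Frostman bound.
The power \<open>1 - t\<close> is the one that Hoelder's inequality pairs with the norm of exponent \<open>1 / t\<close>, so that
flat splittings contract the energy.\<close>

definition energy :: "real \<Rightarrow> (nat \<Rightarrow> 'a \<Rightarrow> real ^ 'l) \<Rightarrow> nat \<Rightarrow> real" where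
  "energy t F n = (\<Sum>\<omega>\<in>atoms (\<F> n). real CARD('m) powr (- \<alpha> * real n) *
     (norm (atom_value (F n) \<omega>) * measure \<nu> (cylinder \<F> n \<omega>) powr (1 - t) * K n powr t))"

lemma energy_nonneg: "0 \<le> energy t F n"
  unfolding energy_def by (intro sum_nonneg) simp

lemma powr_split: "0 \<le> y \<Longrightarrow> y powr (1 - t) * y powr t = (y::real)"
  by (simp flip: powr_add)

lemma integral_le_energy:
  assumes t: "0 \<le> t"
  shows "(LINT \<gamma>|\<nu>. real CARD('m) powr (- \<alpha> * real n) * norm (atom_value (F n) (\<gamma> n))) \<le> energy t F n"
proof -
  have "(LINT \<gamma>|\<nu>. real CARD('m) powr (- \<alpha> * real n) * norm (atom_value (F n) (\<gamma> n)))
      = (\<Sum>\<omega>\<in>atoms (\<F> n). measure \<nu> (cylinder \<F> n \<omega>) *\<^sub>R (real CARD('m) powr (- \<alpha> * real n) * norm (atom_value (F n) \<omega>)))"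
    by (rule has_bochner_integral_integral_eq[OF has_integral_on_paths])
  also have "\<dots> \<le> energy t F n"
    unfolding energy_def
  proof (rule sum_mono)
    fix \<omega> assume \<omega>: "\<omega> \<in> atoms (\<F> n)"
    let ?\<mu> = "measure \<nu> (cylinder \<F> n \<omega>)" and ?x = "norm (atom_value (F n) \<omega>)"
    have "?\<mu> = ?\<mu> powr (1 - t) * ?\<mu> powr t" by (simp add: powr_split)
    also have "\<dots> \<le> ?\<mu> powr (1 - t) * K n powr t"
      using measure_le_K[OF \<omega>] t by (intro mult_left_mono powr_mono2) auto
    finally have "(real CARD('m) powr (- \<alpha> * real n) * ?x) * ?\<mu>
        \<le> (real CARD('m) powr (- \<alpha> * real n) * ?x) * (?\<mu> powr (1 - t) * K n powr t)"
      by (intro mult_left_mono) auto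
    then show "?\<mu> *\<^sub>R (real CARD('m) powr (- \<alpha> * real n) * ?x)
        \<le> real CARD('m) powr (- \<alpha> * real n) * (?x * ?\<mu> powr (1 - t) * K n powr t)"
      by (simp add: mult_ac)
  qed
  finally show ?thesis .
qed

lemma energy_le:
  assumes t: "t \<le> 1"
  shows "energy t F n \<le> C * ((\<Sum>\<omega>\<in>atoms (\<F> n). norm (atom_value (F n) \<omega>)) / real CARD('m) ^ n)"
proof -
  have "energy t F n \<le> (\<Sum>\<omega>\<in>atoms (\<F> n). C / real CARD('m) ^ n * norm (atom_value (F n) \<omega>))"
    unfolding energy_def
  proof (rule sum_mono)
    fix \<omega> assume \<omega>: "\<omega> \<in> atoms (\<F> n)"
    let ?\<mu> = "measure \<nu> (cylinder \<F> n \<omega>)" and ?x = "norm (atom_value (F n) \<omega>)"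
    have "?\<mu> powr (1 - t) * K n powr t \<le> K n powr (1 - t) * K n powr t"
      using measure_le_K[OF \<omega>] t by (intro mult_right_mono powr_mono2) auto
    also have "\<dots> = K n" using K_pos[of n] by (simp add: powr_split)
    finally have "(real CARD('m) powr (- \<alpha> * real n) * ?x) * (?\<mu> powr (1 - t) * K n powr t)
        \<le> (real CARD('m) powr (- \<alpha> * real n) * ?x) * K n"
      by (intro mult_left_mono) auto
    also have "\<dots> = (real CARD('m) powr (- \<alpha> * real n) * K n) * ?x" by (simp only: mult_ac)
    finally show "real CARD('m) powr (- \<alpha> * real n) * (?x * ?\<mu> powr (1 - t) * K n powr t) \<le> C / real CARD('m) ^ n * ?x"
      unfolding weight_K by (simp only: mult_ac)
  qed
  then show ?thesis by (simp add: sum_distrib_left sum_divide_distrib)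
qed

lemma \<WW>_adapted:
  assumes "F \<in> \<WW> M \<F> J W"
  shows "F n \<in> borel_measurable (sigma (space M) (\<F> n))"
  using assms by (auto simp: \<WW>_def martingale_def)

text \<open>From here on only values on atoms matter. For \<open>W \<subseteq> V_pow\<close> the splitting \<open>b\<close> sums to zero, which is
the martingale property on \<open>\<omega>\<close>, since the children are equally likely.\<close>

lemma \<WW>_split:
  assumes F: "F \<in> \<WW> M \<F> J W" and \<omega>: "\<omega> \<in> atoms (\<F> n)"
  obtains b where "b \<in> W" "\<And>j. atom_value (F (Suc n)) (J \<omega> j) = atom_value (F n) \<omega> + b $ j"
proof -
  obtain b where b: "b \<in> W" "\<And>j x. x \<in> J \<omega> j \<Longrightarrow> martingale_diff F (Suc n) x = b $ j"
    using F \<omega> unfolding \<WW>_def by blast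
  have "atom_value (F (Suc n)) (J \<omega> j) = atom_value (F n) \<omega> + b $ j" for j
  proof -
    obtain x where x: "x \<in> J \<omega> j" using child(1)[OF \<omega>] atoms_nonempty by blast
    have "atom_value (F (Suc n)) (J \<omega> j) = F (Suc n) x"
      by (rule atom_value_eq[OF \<WW>_adapted[OF F] child(1)[OF \<omega>] x])
    moreover have "atom_value (F n) \<omega> = F n x"
      using child(2)[OF \<omega>] x by (intro atom_value_eq[OF \<WW>_adapted[OF F] \<omega>]) blast
    ultimately show ?thesis using b(2)[OF x] by (simp add: martingale_diff_def algebra_simps)
  qed
  then show ?thesis using that b(1) by blast
qed

lemma \<WW>_norm_bound:
  assumes "F \<in> \<WW> M \<F> J W"
  shows "(LINT x|M. norm (F n x)) \<le> norm_\<WW> M F"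
  using assms unfolding norm_\<WW>_def \<WW>_def by (intro cSUP_upper) auto

text \<open>The estimate for a single splitting, weighted with \<open>m powr (- \<alpha> * n)\<close> and summed over the atoms of
level \<open>n\<close>. The weight turns the Frostman bound \<open>K n\<close> into \<open>C / m ^ n\<close>, that is, up to \<open>C\<close> into the
probability of the atom, so the increases of the mean norms add up to the increase of the
expectation.\<close>

lemma energy_step:
  fixes W :: "((real ^ 'l) ^ 'm) set"
  assumes W: "W \<subseteq> V_pow" and F: "F \<in> \<WW> M \<F> J W" and t: "0 < t" "t < 1" and \<epsilon>: "0 < \<epsilon>"
    and flat: "\<And>x b. b \<in> W \<Longrightarrow> avg (\<lambda>j. norm (x + b $ j)) \<le> (1 + \<epsilon>) * norm x \<Longrightarrow>
       avg (\<lambda>j. norm (x + b $ j) powr (1 / t)) powr t \<le> exp R * norm x"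
  shows "energy t F (Suc n) \<le> exp (R - \<alpha> * (1 - t) * ln (real CARD('m))) * energy t F n
    + (1 + 1 / \<epsilon>) * C * ((LINT x|M. norm (F (Suc n) x)) - (LINT x|M. norm (F n x)))"
proof -
  let ?\<rho> = "exp (R - \<alpha> * (1 - t) * ln (real CARD('m)))" and ?w = "real CARD('m) powr (- \<alpha> * real n)"
  let ?\<mu> = "\<lambda>n \<omega>. measure \<nu> (cylinder \<F> n \<omega>)"
  let ?x = "\<lambda>n \<omega>. norm (atom_value (F n) \<omega>)"
  have "energy t F (Suc n) = (\<Sum>\<omega>\<in>atoms (\<F> n). ?w * (real CARD('m) powr (- \<alpha>) *
      (\<Sum>j\<in>UNIV. ?x (Suc n) (J \<omega> j) * ?\<mu> (Suc n) (J \<omega> j) powr (1 - t) * (real CARD('m) powr (\<alpha> - 1) * K n) powr t)))"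
  proof -
    have "real CARD('m) powr (- \<alpha> * real (Suc n)) = ?w * real CARD('m) powr (- \<alpha>)"
      unfolding powr_add[symmetric] by (simp add: algebra_simps)
    then show ?thesis
      unfolding energy_def sum_atoms_Suc K_Suc by (simp only: sum_distrib_left mult.assoc)
  qed
  also have "\<dots> \<le> (\<Sum>\<omega>\<in>atoms (\<F> n). ?w * (?\<rho> * (?x n \<omega> * ?\<mu> n \<omega> powr (1 - t) * K n powr t)
      + (1 + 1 / \<epsilon>) * K n * (avg (\<lambda>j. ?x (Suc n) (J \<omega> j)) - ?x n \<omega>)))"
  proof (intro sum_mono mult_left_mono)
    fix \<omega> assume \<omega>: "\<omega> \<in> atoms (\<F> n)"
    obtain b where b: "b \<in> W" "\<And>j. atom_value (F (Suc n)) (J \<omega> j) = atom_value (F n) \<omega> + b $ j"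
      using \<WW>_split[OF F \<omega>] by blast
    show "real CARD('m) powr (- \<alpha>) *
      (\<Sum>j\<in>UNIV. ?x (Suc n) (J \<omega> j) * ?\<mu> (Suc n) (J \<omega> j) powr (1 - t) * (real CARD('m) powr (\<alpha> - 1) * K n) powr t)
      \<le> ?\<rho> * (?x n \<omega> * ?\<mu> n \<omega> powr (1 - t) * K n powr t)
      + (1 + 1 / \<epsilon>) * K n * (avg (\<lambda>j. ?x (Suc n) (J \<omega> j)) - ?x n \<omega>)"
      unfolding b(2)
    proof (rule energy_step_single_split[OF _ t \<epsilon> flat[OF b(1)] K_pos])
      show "b \<in> V_pow" using b(1) W by blast
      show "measure \<nu> (cylinder \<F> (Suc n) (J \<omega> j)) \<le> real CARD('m) powr (\<alpha> - 1) * K n" for j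
        using measure_le_K[OF child(1)[OF \<omega>]] by (simp only: K_Suc)
      show "(\<Sum>j\<in>UNIV. measure \<nu> (cylinder \<F> (Suc n) (J \<omega> j))) \<le> measure \<nu> (cylinder \<F> n \<omega>)"
        by (rule sum_measure_children_le[OF \<omega>])
    qed auto
  qed simp
  also have "\<dots> = ?\<rho> * energy t F n
      + (1 + 1 / \<epsilon>) * (\<Sum>\<omega>\<in>atoms (\<F> n). (?w * K n) * (avg (\<lambda>j. ?x (Suc n) (J \<omega> j)) - ?x n \<omega>))"
    unfolding energy_def sum_distrib_left sum.distrib[symmetric]
    by (intro sum.cong refl) (simp add: algebra_simps)
  also have "(\<Sum>\<omega>\<in>atoms (\<F> n). (?w * K n) * (avg (\<lambda>j. ?x (Suc n) (J \<omega> j)) - ?x n \<omega>))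
      = C * ((\<Sum>\<omega>\<in>atoms (\<F> n). avg (\<lambda>j. ?x (Suc n) (J \<omega> j))) / real CARD('m) ^ n - (\<Sum>\<omega>\<in>atoms (\<F> n). ?x n \<omega>) / real CARD('m) ^ n)"
    unfolding weight_K by (simp only: sum_subtractf diff_divide_distrib[symmetric] sum_distrib_left[symmetric]) simp
  also have "(\<Sum>\<omega>\<in>atoms (\<F> n). avg (\<lambda>j. ?x (Suc n) (J \<omega> j))) / real CARD('m) ^ n = (LINT x|M. norm (F (Suc n) x))"
    unfolding integral_norm_adapted[OF \<WW>_adapted[OF F]] sum_atoms_Suc avg_def
    by (simp flip: sum_divide_distrib)
  also have "(\<Sum>\<omega>\<in>atoms (\<F> n). ?x n \<omega>) / real CARD('m) ^ n = (LINT x|M. norm (F n x))"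
    unfolding integral_norm_adapted[OF \<WW>_adapted[OF F]] ..
  finally show ?thesis by (simp only: mult.assoc)
qed

lemma sum_energy_bound:
  fixes W :: "((real ^ 'l) ^ 'm) set"
  assumes W: "subspace W" "W \<subseteq> V_pow" and \<alpha>: "\<alpha> > - kappa_left_deriv_1 W / ln (real CARD('m))"
  obtains t B where "0 < t" "0 \<le> B"
    "\<And>F N. F \<in> \<WW> M \<F> J W \<Longrightarrow> (\<Sum>n<N. energy t F n) \<le> B * norm_\<WW> M F"
proof -
  have m1: "1 < real CARD('m)" using m2 by simp
  obtain t where t: "0 < t" "t < 1" and kt: "kappa W t < \<alpha> * (1 - t) * ln (real CARD('m))"
    using exists_exponent_below_alpha[OF W(1) m1 \<alpha>] by blast
  obtain R where R: "kappa W t < R" "R < \<alpha> * (1 - t) * ln (real CARD('m))"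
    using dense[OF kt] by blast
  obtain \<epsilon> where \<epsilon>: "0 < \<epsilon>"
    and flat: "\<And>x b. b \<in> W \<Longrightarrow> avg (\<lambda>j. norm (x + b $ j)) \<le> (1 + \<epsilon>) * norm x \<Longrightarrow>
       avg (\<lambda>j. norm (x + b $ j) powr (1 / t)) powr t \<le> exp R * norm x"
    using flat_growth[OF W t(1) R(1)] by blast
  define \<rho> where "\<rho> = exp (R - \<alpha> * (1 - t) * ln (real CARD('m)))"
  define D where "D = (1 + 1 / \<epsilon>) * C"
  have \<rho>: "\<rho> < 1" using R(2) by (simp add: \<rho>_def)
  have D: "0 \<le> D" using \<epsilon> C_pos by (simp add: D_def)
  show ?thesis
  proof (rule that[OF t(1)])
    show "0 \<le> (C + D) / (1 - \<rho>)" using \<rho> D C_pos by simp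
    fix F :: "nat \<Rightarrow> 'a \<Rightarrow> real ^ 'l" and N assume F: "F \<in> \<WW> M \<F> J W"
    have "(\<Sum>n<N. energy t F n) \<le> (C + D) * norm_\<WW> M F / (1 - \<rho>)"
    proof (rule sum_bounded_of_contraction[where E = "\<lambda>n. LINT x|M. norm (F n x)"])
      show "energy t F 0 \<le> C * norm_\<WW> M F"
      proof -
        have "energy t F 0 \<le> C * (LINT x|M. norm (F 0 x))"
          using energy_le[of t F 0] t unfolding integral_norm_adapted[OF \<WW>_adapted[OF F]] by simp
        also have "\<dots> \<le> C * norm_\<WW> M F"
          using C_pos \<WW>_norm_bound[OF F] by (intro mult_left_mono) auto
        finally show ?thesis .
      qed
      show "energy t F (Suc n) \<le> \<rho> * energy t F n
          + D * ((LINT x|M. norm (F (Suc n) x)) - (LINT x|M. norm (F n x)))" for n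
        unfolding \<rho>_def D_def by (rule energy_step[OF W(2) F t \<epsilon> flat])
    qed (use \<rho> D energy_nonneg \<WW>_norm_bound[OF F] in auto)
    then show "(\<Sum>n<N. energy t F n) \<le> (C + D) / (1 - \<rho>) * norm_\<WW> M F" by simp
  qed
qed

section \<open>The Riesz potential\<close>

text \<open>The point chosen in the atom of level \<open>Suc n\<close> also lies in the atom of level \<open>n\<close>, where \<open>F n\<close> is
constant.\<close>

lemma on_paths_martingale_diff:
  assumes F: "F \<in> \<WW> M \<F> J W" and \<gamma>: "\<gamma> \<in> paths \<F>"
  shows "on_paths (Suc n) (martingale_diff F (Suc n)) \<gamma>
           = atom_value (F (Suc n)) (\<gamma> (Suc n)) - atom_value (F n) (\<gamma> n)"
proof -
  define x where "x = (SOME x. x \<in> \<gamma> (Suc n))"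
  have "x \<in> \<gamma> (Suc n)"
    unfolding x_def using atoms_nonempty[OF path_in_atoms[OF \<gamma>]] by (simp add: some_in_eq)
  then have "x \<in> \<gamma> n"
    using path_in_children[OF \<gamma>, of n] by (auto simp: children_def)
  then have "atom_value (F n) (\<gamma> n) = F n x"
    by (rule atom_value_eq[OF \<WW>_adapted[OF F] path_in_atoms[OF \<gamma>]])
  then show ?thesis
    by (simp add: on_paths_def martingale_diff_def atom_value_def x_def)
qed

lemma riesz_term_integrable:
  "integrable \<nu> (\<lambda>\<gamma>. r *\<^sub>R on_paths n (f :: 'a \<Rightarrow> real ^ 'l) \<gamma>)"
  unfolding on_paths_atom_value
  by (rule integrable.intros[OF has_integral_on_paths[where g = "\<lambda>\<omega>. r *\<^sub>R atom_value f \<omega>"]])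

text \<open>The triangle inequality suffices here, since the energy bound makes even the separate series of
\<open>m powr (- \<alpha> * n) * norm (F n)\<close> and of its shift converge in the mean.\<close>

lemma riesz_term_le_energy:
  assumes F: "F \<in> \<WW> M \<F> J W" and t: "0 \<le> t"
  shows "(LINT \<gamma>|\<nu>. norm (real CARD('m) powr (- \<alpha> * real (Suc n)) *\<^sub>R on_paths (Suc n) (martingale_diff F (Suc n)) \<gamma>))
    \<le> energy t F (Suc n) + real CARD('m) powr (- \<alpha>) * energy t F n"
proof -
  let ?a = "\<lambda>n \<gamma>. real CARD('m) powr (- \<alpha> * real n) * norm (atom_value (F n) (\<gamma> n))"
  have int: "integrable \<nu> (?a n)" for n
    by (rule integrable.intros[OF has_integral_on_paths[where g = "\<lambda>\<omega>. real CARD('m) powr (- \<alpha> * real n) * norm (atom_value (F n) \<omega>)"]])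
  have "(LINT \<gamma>|\<nu>. norm (real CARD('m) powr (- \<alpha> * real (Suc n)) *\<^sub>R on_paths (Suc n) (martingale_diff F (Suc n)) \<gamma>))
      \<le> (LINT \<gamma>|\<nu>. ?a (Suc n) \<gamma> + real CARD('m) powr (- \<alpha>) * ?a n \<gamma>)"
  proof (rule integral_mono)
    show "integrable \<nu> (\<lambda>\<gamma>. ?a (Suc n) \<gamma> + real CARD('m) powr (- \<alpha>) * ?a n \<gamma>)"
      by (intro Bochner_Integration.integrable_add integrable_mult_right int)
    fix \<gamma> assume "\<gamma> \<in> space \<nu>"
    then have \<gamma>: "\<gamma> \<in> paths \<F>" by (simp add: space_nu)
    have w: "real CARD('m) powr (- \<alpha> * real (Suc n)) = real CARD('m) powr (- \<alpha>) * real CARD('m) powr (- \<alpha> * real n)"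
      unfolding powr_add[symmetric] by (simp add: algebra_simps)
    have "norm (real CARD('m) powr (- \<alpha> * real (Suc n)) *\<^sub>R on_paths (Suc n) (martingale_diff F (Suc n)) \<gamma>)
        \<le> real CARD('m) powr (- \<alpha> * real (Suc n)) * (norm (atom_value (F (Suc n)) (\<gamma> (Suc n))) + norm (atom_value (F n) (\<gamma> n)))"
      unfolding on_paths_martingale_diff[OF F \<gamma>] norm_scaleR
      by (simp add: mult_left_mono norm_triangle_ineq4)
    also have "\<dots> = ?a (Suc n) \<gamma> + real CARD('m) powr (- \<alpha>) * ?a n \<gamma>"
      by (simp only: distrib_left) (simp only: w mult.assoc)
    finally show "norm (real CARD('m) powr (- \<alpha> * real (Suc n)) *\<^sub>R on_paths (Suc n) (martingale_diff F (Suc n)) \<gamma>)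
        \<le> ?a (Suc n) \<gamma> + real CARD('m) powr (- \<alpha>) * ?a n \<gamma>" .
  qed (intro Bochner_Integration.integrable_norm riesz_term_integrable)
  also have "\<dots> = (LINT \<gamma>|\<nu>. ?a (Suc n) \<gamma>) + real CARD('m) powr (- \<alpha>) * (LINT \<gamma>|\<nu>. ?a n \<gamma>)"
    unfolding Bochner_Integration.integral_add[OF int integrable_mult_right[OF int]] integral_mult_right_zero ..
  also have "\<dots> \<le> energy t F (Suc n) + real CARD('m) powr (- \<alpha>) * energy t F n"
    by (intro add_mono mult_left_mono integral_le_energy[OF t]) auto
  finally show ?thesis .
qed

lemma riesz_potential_continuous:
  fixes W :: "((real ^ 'l) ^ 'm) set"
  assumes W: "subspace W" "W \<subseteq> V_pow" and \<alpha>: "\<alpha> > - kappa_left_deriv_1 W / ln (real CARD('m))"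
  shows "riesz_continuous CARD('m) \<alpha> M (\<WW> M \<F> J W) \<nu>"
proof -
  obtain t B where t: "0 < t" and B: "0 \<le> B"
    and bound: "\<And>F N. F \<in> \<WW> M \<F> J W \<Longrightarrow> (\<Sum>n<N. energy t F n) \<le> B * norm_\<WW> M F"
    using sum_energy_bound[OF assms] by blast
  define B' where "B' = (1 + real CARD('m) powr (- \<alpha>)) * B"
  show ?thesis
    unfolding riesz_continuous_def
  proof (intro exI[of _ B'] ballI)
    fix F assume F: "F \<in> \<WW> M \<F> J W"
    define h where "h n \<gamma> = real CARD('m) powr (- \<alpha> * real (Suc n)) *\<^sub>R on_paths (Suc n) (martingale_diff F (Suc n)) \<gamma>"
      for n \<gamma>
    have int: "integrable \<nu> (h n)" for n
      unfolding h_def by (rule riesz_term_integrable)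
    have nn: "0 \<le> (LINT \<gamma>|\<nu>. norm (h n \<gamma>))" for n
      by (rule integral_nonneg_AE) auto
    have partial: "(\<Sum>n<N. LINT \<gamma>|\<nu>. norm (h n \<gamma>)) \<le> B' * norm_\<WW> M F" for N
    proof -
      have "(\<Sum>n<N. LINT \<gamma>|\<nu>. norm (h n \<gamma>)) \<le> (\<Sum>n<N. energy t F (Suc n) + real CARD('m) powr (- \<alpha>) * energy t F n)"
        unfolding h_def using t by (intro sum_mono riesz_term_le_energy[OF F]) auto
      also have "\<dots> = (\<Sum>n<N. energy t F (Suc n)) + real CARD('m) powr (- \<alpha>) * (\<Sum>n<N. energy t F n)"
        by (simp only: sum.distrib sum_distrib_left)
      also have "(\<Sum>n<N. energy t F (Suc n)) \<le> (\<Sum>n<Suc N. energy t F n)"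
        unfolding sum.lessThan_Suc_shift using energy_nonneg[of t F 0] by simp
      also have "(\<Sum>n<Suc N. energy t F n) \<le> B * norm_\<WW> M F" by (rule bound[OF F])
      also have "real CARD('m) powr (- \<alpha>) * (\<Sum>n<N. energy t F n) \<le> real CARD('m) powr (- \<alpha>) * (B * norm_\<WW> M F)"
        by (intro mult_left_mono bound[OF F]) simp
      finally show ?thesis by (simp add: B'_def algebra_simps)
    qed
    have sm: "summable (\<lambda>n. LINT \<gamma>|\<nu>. norm (h n \<gamma>))"
      by (rule summableI_nonneg_bounded[OF nn partial])
    have S: "riesz_partial_sum CARD('m) \<alpha> F = (\<lambda>N \<gamma>. \<Sum>n<N. h n \<gamma>)"
      by (intro ext) (simp add: riesz_partial_sum_def h_def sum.atLeast1_atMost_eq)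
    have "(LINT \<gamma>|\<nu>. norm (\<Sum>n. h n \<gamma>)) \<le> B' * norm_\<WW> M F"
      using L1_converges_series(2)[OF int sm] suminf_le_const[OF sm partial] by linarith
    then show "\<exists>G. L1_converges \<nu> (riesz_partial_sum CARD('m) \<alpha> F) G \<and>
        (LINT \<gamma>|\<nu>. norm (G \<gamma>)) \<le> B' * norm_\<WW> M F"
      unfolding S using L1_converges_series(1)[OF int sm] by blast
  qed
qed

end

theorem theorem6p2:
  fixes M :: "'a measure"
    and \<F> :: "nat \<Rightarrow> 'a set set"
    and J :: "'a set \<Rightarrow> 'm::finite \<Rightarrow> 'a set"
    and W :: "((real ^ 'l) ^ 'm) set"
    and \<nu> :: "(nat \<Rightarrow> 'a set) measure"
    and \<alpha> :: real
  assumes "CARD('m) \<ge> 3"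
    and "uniform_filtration CARD('m) M \<F>"
    and "children_labelling \<F> J"
    and "subspace W" and "W \<subseteq> V_pow"
    and "finite_borel_measure_on_paths CARD('m) \<F> \<nu>"
    and "frostman CARD('m) \<F> \<alpha> \<nu>"
    and "\<alpha> > - kappa_left_deriv_1 W / ln (real CARD('m))"
  shows "riesz_continuous CARD('m) \<alpha> M (\<WW> M \<F> J W) \<nu>"
proof -
  obtain C where C: "\<And>n \<omega>. \<omega> \<in> atoms (\<F> n) \<Longrightarrow>
      measure \<nu> (cylinder \<F> n \<omega>) \<le> C * real CARD('m) powr ((\<alpha> - 1) * real n)"
    using assms(7) unfolding frostman_def by blast
  \<comment> \<open>The Frostman constant may be \<open>0\<close>; the energy needs a positive bound \<open>K n\<close>.\<close>
  interpret frostman_tree M \<F> J \<nu> \<alpha> "max C 1"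
  proof
    fix n \<omega> assume "\<omega> \<in> atoms (\<F> n)"
    then have "measure \<nu> (cylinder \<F> n \<omega>) \<le> C * real CARD('m) powr ((\<alpha> - 1) * real n)"
      by (rule C)
    also have "\<dots> \<le> max C 1 * real CARD('m) powr ((\<alpha> - 1) * real n)"
      by (intro mult_right_mono) auto
    finally show "measure \<nu> (cylinder \<F> n \<omega>) \<le> max C 1 * real CARD('m) powr ((\<alpha> - 1) * real n)" .
  qed (use assms in auto)
  show ?thesis by (rule riesz_potential_continuous[OF assms(4,5,8)])
qed

end
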